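(* The recoverable robust representatives selection problem with discrete budgeted uncertainty and $\Gamma=k=1$ and $p_j=1$, $n_j=2$ for all $j\in[K]$ can be solved in strongly polynomial time $O(n^3)$. That is, there is a strongly polynomial algorithm which, given an instance $(n,T_1,\ldots,T_K,C,\underline{c},d)$ with $|T_j|=2$ for all $j\in[K]$ (so $n=2K$), computes in $O(n^3)$ time an optimal solution $x\in\mathcal{X}$ of $$\min_{x\in\mathcal{X}}\ \Big(\sum_{i\in[n]}C_ix_i+\max_{c\in\mathcal{U}}\ \min_{y\in R(x)}\sum_{i\in[n]}c_iy_i\Big),$$ where $\Gamma=k=1$.
   Context: Notation: $[n]=\{1,\ldots,n\}$. The item set $[n]$ is partitioned into disjoint parts $T_1,\ldots,T_K$, with $n_j=|T_j|$. With $p_j=1$ for all $j$, the set of feasible solutions is $\mathcal{X}=\{x\in\{0,1\}^n:\sum_{i\in T_j}x_i=1\ \forall j\in[K]\}$. $C\in\mathbb{R}^n$ are the first-stage costs. Discrete budgeted uncertainty: given $\underline{c}\in\mathbb{R}^n$, $d\in\mathbb{R}^n$ with $d_i\ge 0$, and a nonnegative integer $\Gamma$, $$\mathcal{U}=\Big\{c\in\mathbb{R}^n : c_i=\underline{c}_i+d_i\delta_i,\ \delta_i\in\{0,1\},\ \sum_{i\in[n]}\delta_i\le\Gamma\Big\}.$$ Recovery: given a nonnegative integer $k$, $R(x)=\{y\in\mathcal{X}:\sum_{i\in[n]}|x_i-y_i|\le 2k\}$. Running time counts elementary arithmetic operations and comparisons on the input numbers; strongly polynomial means this count is bounded by a polynomial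 in $n$, independently of the sizes of the numbers, and the algorithm runs in polynomial space on rational input. *)

theory Defs
  imports
    Complex_Main
    "HOL-Library.FuncSet"
    "HOL-Library.Disjoint_Sets"
    "HOL-Library.Log_Nat"
    "HOL-Library.Landau_Symbols"
    "HOL-Computational_Algebra.Polynomial"
begin

section \<open>Recoverable robust representatives selection\<close>

text \<open>Items are \<open>1, \<dots>, n\<close> and parts are \<open>1, \<dots>, K\<close>. Only the values at items (parts) of the
  cost functions (of \<open>part\<close>) are part of an instance; the values elsewhere are irrelevant.\<close>

record rs_instance =
  num_items :: nat
  num_parts :: nat
  part :: "nat \<Rightarrow> nat set"
  first_cost :: "nat \<Rightarrow> real"
  base_cost :: "nat \<Rightarrow> real"
  deviation :: "nat \<Rightarrow> real"

definition items :: "rs_instance \<Rightarrow> nat set" where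
  "items I = {1..num_items I}"

definition valid_instance :: "rs_instance \<Rightarrow> bool" where
  "valid_instance I \<longleftrightarrow>
     disjoint_family_on (part I) {1..num_parts I} \<and>
     (\<Union>j\<in>{1..num_parts I}. part I j) = items I \<and>
     (\<forall>i\<in>items I. 0 \<le> deviation I i)"

definition feasible :: "rs_instance \<Rightarrow> (nat \<Rightarrow> nat) \<Rightarrow> (nat \<Rightarrow> real) set" where
  "feasible I p =
     {x \<in> items I \<rightarrow>\<^sub>E {0, 1}. \<forall>j\<in>{1..num_parts I}. (\<Sum>i\<in>part I j. x i) = real (p j)}"

definition uncertainty :: "rs_instance \<Rightarrow> nat \<Rightarrow> (nat \<Rightarrow> real) set" where
  "uncertainty I \<Gamma> =
     {\<lambda>i\<in>items I. base_cost I i + deviation I i * \<delta> i | \<delta>.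
        \<delta> \<in> items I \<rightarrow>\<^sub>E {0, 1} \<and> (\<Sum>i\<in>items I. \<delta> i) \<le> real \<Gamma>}"

definition recovery ::
    "rs_instance \<Rightarrow> (nat \<Rightarrow> nat) \<Rightarrow> nat \<Rightarrow> (nat \<Rightarrow> real) \<Rightarrow> (nat \<Rightarrow> real) set" where
  "recovery I p k x = {y \<in> feasible I p. (\<Sum>i\<in>items I. \<bar>x i - y i\<bar>) \<le> 2 * real k}"

text \<open>The sets \<open>uncertainty I \<Gamma>\<close> and \<open>recovery I p k x\<close> are finite, and nonempty for feasible \<open>x\<close>,
  so that maximum and minimum are attained.\<close>

definition objective ::
    "rs_instance \<Rightarrow> (nat \<Rightarrow> nat) \<Rightarrow> nat \<Rightarrow> nat \<Rightarrow> (nat \<Rightarrow> real) \<Rightarrow> real" where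
  "objective I p \<Gamma> k x =
     (\<Sum>i\<in>items I. first_cost I i * x i) +
     (MAX c\<in>uncertainty I \<Gamma>. MIN y\<in>recovery I p k x. \<Sum>i\<in>items I. c i * y i)"

definition optimal_solution ::
    "rs_instance \<Rightarrow> (nat \<Rightarrow> nat) \<Rightarrow> nat \<Rightarrow> nat \<Rightarrow> (nat \<Rightarrow> real) \<Rightarrow> bool" where
  "optimal_solution I p \<Gamma> k x \<longleftrightarrow>
     is_arg_min (objective I p \<Gamma> k) (\<lambda>x. x \<in> feasible I p) x"


section \<open>A random access machine over the reals\<close>

text \<open>Besides registers and arrays for real numbers, on which only the four arithmetic operations
  and comparisons are available, there are registers and arrays of natural numbers for control and
  addressing. The latter support only copying, successor, predecessor and comparison, so that
  values in them are bounded by the number of executed steps plus the largest natural number in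
  the input and the program; in particular no arithmetic on large numbers can be hidden there. Every instruction and
  every test takes one unit of time. Division by zero yields zero.\<close>

record state =
  ireg :: "nat \<Rightarrow> nat"
  iarr :: "nat \<Rightarrow> nat \<Rightarrow> nat"
  rreg :: "nat \<Rightarrow> real"
  rarr :: "nat \<Rightarrow> nat \<Rightarrow> real"

datatype arith_op = Plus | Minus | Times | Divide

fun arith :: "arith_op \<Rightarrow> real \<Rightarrow> real \<Rightarrow> real" where
  "arith Plus x y = x + y"
| "arith Minus x y = x - y"
| "arith Times x y = x * y"
| "arith Divide x y = x / y"

datatype instr =
    IConst nat nat
  | ICopy nat nat
  | ISuc nat
  | IPred nat
  | ILoad nat nat nat
  | IStore nat nat nat
  | RConst nat int
  | RArith nat arith_op nat nat
  | RLoad nat nat nat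
  | RStore nat nat nat

text \<open>In loads and stores the array is fixed by the program, and the position in the array is the
  content of an index register.\<close>

fun step :: "instr \<Rightarrow> state \<Rightarrow> state" where
  "step (IConst r m) s = s\<lparr>ireg := (ireg s)(r := m)\<rparr>"
| "step (ICopy r q) s = s\<lparr>ireg := (ireg s)(r := ireg s q)\<rparr>"
| "step (ISuc r) s = s\<lparr>ireg := (ireg s)(r := ireg s r + 1)\<rparr>"
| "step (IPred r) s = s\<lparr>ireg := (ireg s)(r := ireg s r - 1)\<rparr>"
| "step (ILoad r a q) s = s\<lparr>ireg := (ireg s)(r := iarr s a (ireg s q))\<rparr>"
| "step (IStore a q r) s = s\<lparr>iarr := (iarr s)(a := (iarr s a)(ireg s q := ireg s r))\<rparr>"
| "step (RConst r z) s = s\<lparr>rreg := (rreg s)(r := of_int z)\<rparr>"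
| "step (RArith r f q q') s = s\<lparr>rreg := (rreg s)(r := arith f (rreg s q) (rreg s q'))\<rparr>"
| "step (RLoad r a q) s = s\<lparr>rreg := (rreg s)(r := rarr s a (ireg s q))\<rparr>"
| "step (RStore a q r) s = s\<lparr>rarr := (rarr s)(a := (rarr s a)(ireg s q := rreg s r))\<rparr>"

datatype test = IEq nat nat | ILess nat nat | REq nat nat | RLess nat nat

fun holds :: "test \<Rightarrow> state \<Rightarrow> bool" where
  "holds (IEq r q) s \<longleftrightarrow> ireg s r = ireg s q"
| "holds (ILess r q) s \<longleftrightarrow> ireg s r < ireg s q"
| "holds (REq r q) s \<longleftrightarrow> rreg s r = rreg s q"
| "holds (RLess r q) s \<longleftrightarrow> rreg s r < rreg s q"

datatype prog =
    SKIP
  | INSTR instr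
  | SEQ prog prog
  | IFTE test prog prog
  | WHILE test prog

text \<open>\<open>rat_bits\<close> is meant for rational arguments only.\<close>

definition rat_bits :: "real \<Rightarrow> nat" where
  "rat_bits x =
     (let (a, b) = quotient_of (THE r. x = of_rat r)
      in 1 + floorlog 2 (nat \<bar>a\<bar>) + floorlog 2 (nat b))"

text \<open>All registers and arrays are initially zero except at finitely many positions, and a step
  changes a single cell. Cells containing zero need not be represented. The position of a nonzero
  array cell is charged along with its content, so no information is stored for free in the
  choice of positions.\<close>

definition space :: "state \<Rightarrow> nat" where
  "space s =
     (\<Sum>r\<in>{r. ireg s r \<noteq> 0}. floorlog 2 (ireg s r)) +
     (\<Sum>(a, i)\<in>{(a, i). iarr s a i \<noteq> 0}. floorlog 2 i + floorlog 2 (iarr s a i)) +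
     (\<Sum>r\<in>{r. rreg s r \<noteq> 0}. rat_bits (rreg s r)) +
     (\<Sum>(a, i)\<in>{(a, i). rarr s a i \<noteq> 0}. floorlog 2 i + rat_bits (rarr s a i))"

text \<open>\<open>exec P s t m s'\<close>: started in \<open>s\<close>, the program \<open>P\<close> halts in \<open>s'\<close> after \<open>t\<close> steps, and \<open>m\<close> is the
  maximal space of a state occurring in the run.\<close>

inductive exec :: "prog \<Rightarrow> state \<Rightarrow> nat \<Rightarrow> nat \<Rightarrow> state \<Rightarrow> bool" where
  Skip: "exec SKIP s 1 (space s) s"
| Instr: "exec (INSTR c) s 1 (max (space s) (space (step c s))) (step c s)"
| Seq: "exec P s t m s' \<Longrightarrow> exec Q s' t' m' s'' \<Longrightarrow> exec (SEQ P Q) s (t + t') (max m m') s''"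
| IfTrue: "holds b s \<Longrightarrow> exec P s t m s' \<Longrightarrow> exec (IFTE b P Q) s (1 + t) m s'"
| IfFalse: "\<not> holds b s \<Longrightarrow> exec Q s t m s' \<Longrightarrow> exec (IFTE b P Q) s (1 + t) m s'"
| WhileFalse: "\<not> holds b s \<Longrightarrow> exec (WHILE b P) s 1 (space s) s"
| WhileTrue: "holds b s \<Longrightarrow> exec P s t m s' \<Longrightarrow> exec (WHILE b P) s' t' m' s'' \<Longrightarrow>
    exec (WHILE b P) s (1 + t + t') (max m m') s''"

inductive_cases exec_SkipE: "exec SKIP s t m s'"
inductive_cases exec_InstrE: "exec (INSTR c) s t m s'"
inductive_cases exec_SeqE: "exec (SEQ P Q) s t m s'"
inductive_cases exec_IfE: "exec (IFTE b P Q) s t m s'"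
inductive_cases exec_WhileE: "exec (WHILE b P) s t m s'"

lemma exec_deterministic:
  "exec P s t m s' \<Longrightarrow> exec P s u l s'' \<Longrightarrow> t = u \<and> m = l \<and> s' = s''"
proof (induction arbitrary: u l s'' rule: exec.induct)
  case (Skip s)
  then show ?case by (auto elim: exec_SkipE)
next
  case (Instr c s)
  then show ?case by (auto elim: exec_InstrE)
next
  case (Seq P s t m s' Q t' m' s1)
  from Seq.prems obtain t1 m1 r t2 m2 where
    "exec P s t1 m1 r" "exec Q r t2 m2 s''" "u = t1 + t2" "l = max m1 m2"
    by (rule exec_SeqE)
  with Seq.IH(1)[OF this(1)] Seq.IH(2) show ?case by simp
next
  case (IfTrue b s P t m s' Q)
  from IfTrue.prems IfTrue.hyps(1) obtain t1 where "exec P s t1 l s''" "u = 1 + t1"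
    by (auto elim: exec_IfE)
  with IfTrue.IH[OF this(1)] show ?case by simp
next
  case (IfFalse b s Q t m s' P)
  from IfFalse.prems IfFalse.hyps(1) obtain t1 where "exec Q s t1 l s''" "u = 1 + t1"
    by (auto elim: exec_IfE)
  with IfFalse.IH[OF this(1)] show ?case by simp
next
  case (WhileFalse b s P)
  from WhileFalse.prems WhileFalse.hyps(1) show ?case
    by (auto elim: exec_WhileE)
next
  case (WhileTrue b s P t m s' t' m' s1)
  from WhileTrue.prems WhileTrue.hyps(1) obtain t1 m1 r t2 m2 where
    "exec P s t1 m1 r" "exec (WHILE b P) r t2 m2 s''" "u = 1 + t1 + t2" "l = max m1 m2"
    by (cases rule: exec_WhileE) auto
  with WhileTrue.IH(1)[OF this(1)] WhileTrue.IH(2) show ?case by simp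
qed


section \<open>Strongly polynomial algorithms for the selection problem\<close>

definition part_index :: "rs_instance \<Rightarrow> nat \<Rightarrow> nat" where
  "part_index I i = (THE j. j \<in> {1..num_parts I} \<and> i \<in> part I j)"

text \<open>Input: \<open>n\<close> and \<open>K\<close> in index registers 0 and 1, the index of the part of each item in index
  array 0, and \<open>C\<close>, \<open>c\<close>, \<open>d\<close> in real arrays 0, 1, 2. Output: the entries of \<open>x\<close> in index array 1.\<close>

definition initial :: "rs_instance \<Rightarrow> state" where
  "initial I =
     \<lparr>ireg = (\<lambda>_. 0)(0 := num_items I, 1 := num_parts I),
      iarr = (\<lambda>_ _. 0)(0 := \<lambda>i. if i \<in> items I then part_index I i else 0),
      rreg = (\<lambda>_. 0),
      rarr = (\<lambda>_ _. 0)
        (0 := \<lambda>i. if i \<in> items I then first_cost I i else 0,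
         1 := \<lambda>i. if i \<in> items I then base_cost I i else 0,
         2 := \<lambda>i. if i \<in> items I then deviation I i else 0)\<rparr>"

definition solution :: "rs_instance \<Rightarrow> state \<Rightarrow> nat \<Rightarrow> real" where
  "solution I s = (\<lambda>i\<in>items I. real (iarr s 1 i))"

definition rational_instance :: "rs_instance \<Rightarrow> bool" where
  "rational_instance I \<longleftrightarrow>
     (\<forall>i\<in>items I. first_cost I i \<in> \<rat> \<and> base_cost I i \<in> \<rat> \<and> deviation I i \<in> \<rat>)"

definition encoding_length :: "rs_instance \<Rightarrow> nat" where
  "encoding_length I =
     floorlog 2 (num_items I) + floorlog 2 (num_parts I) +
     (\<Sum>i\<in>items I. floorlog 2 (part_index I i) +
        rat_bits (first_cost I i) + rat_bits (base_cost I i) + rat_bits (deviation I i))"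

definition solves ::
    "prog \<Rightarrow> rs_instance set \<Rightarrow> (nat \<Rightarrow> nat) \<Rightarrow> nat \<Rightarrow> nat \<Rightarrow> bool" where
  "solves P D p \<Gamma> k \<longleftrightarrow>
     (\<forall>I\<in>D. \<exists>t m s. exec P (initial I) t m s \<and> optimal_solution I p \<Gamma> k (solution I s))"

definition time_bounded :: "prog \<Rightarrow> rs_instance set \<Rightarrow> (nat \<Rightarrow> nat) \<Rightarrow> bool" where
  "time_bounded P D f \<longleftrightarrow>
     (\<forall>I\<in>D. \<exists>t m s. exec P (initial I) t m s \<and> t \<le> f (num_items I))"

definition space_bounded :: "prog \<Rightarrow> rs_instance set \<Rightarrow> (nat \<Rightarrow> nat) \<Rightarrow> bool" where
  "space_bounded P D g \<longleftrightarrow>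
     (\<forall>I\<in>D. rational_instance I \<longrightarrow>
        (\<exists>t m s. exec P (initial I) t m s \<and> m \<le> g (encoding_length I)))"

definition strongly_polynomial :: "prog \<Rightarrow> rs_instance set \<Rightarrow> bool" where
  "strongly_polynomial P D \<longleftrightarrow>
     (\<exists>q :: nat poly. time_bounded P D (poly q)) \<and>
     (\<exists>q :: nat poly. space_bounded P D (poly q))"

definition two_item_instances :: "rs_instance set" where
  "two_item_instances =
     {I. valid_instance I \<and> (\<forall>j\<in>{1..num_parts I}. card (part I j) = 2)}"

end

theory Submission
  imports Defs
begin

text \<open>Let \<open>\<sigma> i\<close> be the partner of item \<open>i\<close>. With one swap allowed, the best recovery of a selection \<open>S\<close>
  after an attack on one item is to stay, to swap the attacked item, or to swap one of the two
  items \<open>e, r \<in> S\<close> with the least swapping costs. For fixed \<open>e\<close> the attacks on the other pairs give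
  conditions on single items of \<open>S\<close>, and the attacks on the pair of \<open>e\<close> give a condition on the single
  item \<open>r\<close>. So for fixed \<open>e\<close> and a fixed bound \<open>t\<close> on the adversarial cost, one minimizes a linear function
  over the selections that contain \<open>e\<close>, consist of allowed items, and contain at least one of certain
  fallback items. This takes linear time: choose the cheaper allowed item of each pair, and then
  enforce a fallback item by the swap of least regret. For an arbitrary guess \<open>e, t\<close> the
  value found is an upper bound on the objective, so optimality only needs that the right guess
  is tried; there are \<open>O(n)\<close> candidates for \<open>e\<close> and, given \<open>e\<close>, \<open>O(n)\<close> for \<open>t\<close>.\<close>

text \<open>An attack with budget one touches a single pair, so among the swaps of untouched pairs
  only the cheapest matters: that of \<open>e\<close>, unless the pair of \<open>e\<close> is
  attacked, and then that of \<open>r\<close>. Swapping an attacked item of the selection evades the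
  attack. Once \<open>e\<close> is known, the adversarial cost is a maximum of terms that depend on
  \<open>e\<close> and one further item, so it is one of 2n numbers; this is where the candidates
  for \<open>t\<close> come from. The item \<open>r\<close> need not be guessed. The cost of
  answering an attack on the pair of \<open>e\<close> is nondecreasing in the cost of the swap of
  \<open>r\<close>, so "some item of the selection is good enough as a fallback" says the same as
  "the best fallback is good enough". This turns a minimum over the selection into a covering
  condition, which one exchange can repair. Costs are only added, subtracted and compared. Numbers
  therefore grow by at most one bit per step over a common denominator, and the space bound follows
  from the time bound.\<close>

section \<open>Structured programs with bounded loops\<close>

datatype cond = Atom test | Neg cond | Conj cond cond | Disj cond cond

datatype cmd = Pass | Do instr | Then cmd cmd (infixr ";;" 60) | Cond cond cmd cmd | For nat cmd

text \<open>Short-circuit evaluation copies \<open>Q\<close> for a conjunction and \<open>P\<close>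
  for a disjunction. Only one copy is executed, so the program text grows but the running time does
  not.\<close>

fun branch :: "cond \<Rightarrow> prog \<Rightarrow> prog \<Rightarrow> prog" where
  "branch (Atom b) P Q = IFTE b P Q"
| "branch (Neg b) P Q = branch b Q P"
| "branch (Conj b c) P Q = branch b (branch c P Q) Q"
| "branch (Disj b c) P Q = branch b P (branch c P Q)"

fun compile :: "cmd \<Rightarrow> prog" where
  "compile Pass = SKIP"
| "compile (Do a) = INSTR a"
| "compile (P ;; Q) = SEQ (compile P) (compile Q)"
| "compile (Cond b P Q) = branch b (compile P) (compile Q)"
| "compile (For i P) =
     SEQ (INSTR (IConst i 0)) (WHILE (ILess i 0) (SEQ (INSTR (ISuc i)) (compile P)))"

fun sat :: "cond \<Rightarrow> state \<Rightarrow> bool" where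
  "sat (Atom b) s \<longleftrightarrow> holds b s"
| "sat (Neg b) s \<longleftrightarrow> \<not> sat b s"
| "sat (Conj b c) s \<longleftrightarrow> sat b s \<and> sat c s"
| "sat (Disj b c) s \<longleftrightarrow> sat b s \<or> sat c s"

abbreviation set_ireg :: "nat \<Rightarrow> nat \<Rightarrow> state \<Rightarrow> state" where
  "set_ireg r v s \<equiv> s\<lparr>ireg := (ireg s)(r := v)\<rparr>"

text \<open>Register 0 holds the number of items, so that all loops run from \<open>1\<close> to \<open>ireg s 0\<close>.\<close>

fun loop :: "(state \<Rightarrow> state) \<Rightarrow> nat \<Rightarrow> nat \<Rightarrow> state \<Rightarrow> state" where
  "loop f i 0 s = set_ireg i 0 s"
| "loop f i (Suc k) s = f (set_ireg i (Suc k) (loop f i k s))"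

fun den :: "cmd \<Rightarrow> state \<Rightarrow> state" where
  "den Pass s = s"
| "den (Do a) s = step a s"
| "den (P ;; Q) s = den Q (den P s)"
| "den (Cond b P Q) s = (if sat b s then den P s else den Q s)"
| "den (For i P) s = loop (den P) i (ireg s 0) s"

section \<open>Written cells, well-formed loops and syntactic time bounds\<close>

datatype location = IReg nat | IArr nat | RReg nat | RArr nat

fun instr_writes :: "instr \<Rightarrow> location" where
  "instr_writes (IConst r m) = IReg r"
| "instr_writes (ICopy r q) = IReg r"
| "instr_writes (ISuc r) = IReg r"
| "instr_writes (IPred r) = IReg r"
| "instr_writes (ILoad r a q) = IReg r"
| "instr_writes (IStore a q r) = IArr a"
| "instr_writes (RConst r z) = RReg r"
| "instr_writes (RArith r f q q') = RReg r"
| "instr_writes (RLoad r a q) = RReg r"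
| "instr_writes (RStore a q r) = RArr a"

fun writes :: "cmd \<Rightarrow> location set" where
  "writes Pass = {}"
| "writes (Do a) = {instr_writes a}"
| "writes (P ;; Q) = writes P \<union> writes Q"
| "writes (Cond b P Q) = writes P \<union> writes Q"
| "writes (For i P) = insert (IReg i) (writes P)"

definition agree_off :: "location set \<Rightarrow> state \<Rightarrow> state \<Rightarrow> bool" where
  "agree_off W s s' \<longleftrightarrow>
     (\<forall>r. IReg r \<notin> W \<longrightarrow> ireg s' r = ireg s r) \<and> (\<forall>a. IArr a \<notin> W \<longrightarrow> iarr s' a = iarr s a) \<and>
     (\<forall>r. RReg r \<notin> W \<longrightarrow> rreg s' r = rreg s r) \<and> (\<forall>a. RArr a \<notin> W \<longrightarrow> rarr s' a = rarr s a)"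

text \<open>If moreover the body leaves register 0 alone, these conditions make the number of rounds
  equal to the content of register 0.\<close>

fun loops_ok :: "cmd \<Rightarrow> bool" where
  "loops_ok (P ;; Q) \<longleftrightarrow> loops_ok P \<and> loops_ok Q"
| "loops_ok (Cond b P Q) \<longleftrightarrow> loops_ok P \<and> loops_ok Q"
| "loops_ok (For i P) \<longleftrightarrow> i \<noteq> 0 \<and> IReg i \<notin> writes P \<and> loops_ok P"
| "loops_ok _ \<longleftrightarrow> True"

fun tests :: "cond \<Rightarrow> nat" where
  "tests (Atom b) = 1"
| "tests (Neg b) = tests b"
| "tests (Conj b c) = tests b + tests c"
| "tests (Disj b c) = tests b + tests c"

text \<open>Charging both branches of a conditional gives an upper bound without a maximum. In a
  loop, the outer 2 pays for the initialization and the failing last test, the inner 2 for the test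
  and the increment of each round.\<close>

fun duration :: "cmd \<Rightarrow> nat \<Rightarrow> nat" where
  "duration Pass n = 1"
| "duration (Do a) n = 1"
| "duration (P ;; Q) n = duration P n + duration Q n"
| "duration (Cond b P Q) n = tests b + duration P n + duration Q n"
| "duration (For i P) n = 2 + n * (2 + duration P n)"

fun depth :: "cmd \<Rightarrow> nat" where
  "depth (P ;; Q) = max (depth P) (depth Q)"
| "depth (Cond b P Q) = max (depth P) (depth Q)"
| "depth (For i P) = Suc (depth P)"
| "depth _ = 0"

lemma agree_off_refl: "agree_off W s s"
  by (simp add: agree_off_def)

lemma agree_off_trans: "agree_off W s s' \<Longrightarrow> agree_off W s' s'' \<Longrightarrow> agree_off W s s''"
  by (simp add: agree_off_def)

lemma agree_off_mono:
  assumes "agree_off V s s'" "V \<subseteq> W"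
  shows "agree_off W s s'"
proof -
  have "x \<notin> V" if "x \<notin> W" for x using that assms(2) by auto
  with assms(1) show ?thesis by (simp add: agree_off_def)
qed

lemma agree_off_step: "agree_off {instr_writes a} s (step a s)"
  by (cases a) (simp_all add: agree_off_def)

lemma agree_off_set_ireg: "agree_off (insert (IReg i) W) s (set_ireg i v s)"
  by (simp add: agree_off_def)

lemma agree_off_loop:
  assumes "\<And>s. agree_off W s (f s)"
  shows "agree_off (insert (IReg i) W) s (loop f i k s)"
proof (induction k)
  case 0
  show ?case by (simp add: agree_off_set_ireg)
next
  case (Suc k)
  have "agree_off (insert (IReg i) W) (set_ireg i (Suc k) (loop f i k s)) (loop f i (Suc k) s)"
    unfolding loop.simps by (rule agree_off_mono[OF assms subset_insertI])
  from agree_off_trans[OF agree_off_trans[OF Suc agree_off_set_ireg] this] show ?case .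
qed

lemma agree_off_den: "agree_off (writes P) s (den P s)"
proof (induction P arbitrary: s)
  case (Then P Q)
  have "agree_off (writes P \<union> writes Q) s (den P s)"
    "agree_off (writes P \<union> writes Q) (den P s) (den Q (den P s))"
    by (rule agree_off_mono[OF Then.IH(1)] agree_off_mono[OF Then.IH(2)]; simp)+
  from agree_off_trans[OF this] show ?case by simp
next
  case (Cond b P Q)
  have "agree_off (writes P \<union> writes Q) s (den P s)" "agree_off (writes P \<union> writes Q) s (den Q s)"
    by (rule agree_off_mono[OF Cond.IH(1)] agree_off_mono[OF Cond.IH(2)]; simp)+
  then show ?case by simp
next
  case (For i P)
  then show ?case by (simp add: agree_off_loop)
qed (auto simp: agree_off_refl agree_off_step)

lemma den_unwritten:
  "IReg r \<notin> writes P \<Longrightarrow> ireg (den P s) r = ireg s r"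
  "IArr a \<notin> writes P \<Longrightarrow> iarr (den P s) a = iarr s a"
  "RReg r \<notin> writes P \<Longrightarrow> rreg (den P s) r = rreg s r"
  "RArr a \<notin> writes P \<Longrightarrow> rarr (den P s) a = rarr s a"
  using agree_off_den[of P s] by (simp_all add: agree_off_def)

lemma ireg_loop_unwritten:
  assumes "\<And>s. ireg (f s) r = ireg s r" "r \<noteq> i"
  shows "ireg (loop f i k s) r = ireg s r"
  by (induction k) (use assms in auto)

lemma ireg_loop_counter:
  assumes "\<And>s. ireg (f s) i = ireg s i"
  shows "ireg (loop f i k s) i = k"
  using assms by (cases k) auto

text \<open>The state \<open>s'\<close> keeps all cells that the loop does not write, so invariants need not mention them.\<close>

lemma For_invariant:
  assumes "Q 0 (set_ireg i 0 s)"
    and "\<And>k s'. k < ireg s 0 \<Longrightarrow> agree_off (insert (IReg i) (writes P)) s s' \<Longrightarrow> Q k s' \<Longrightarrow>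
      Q (Suc k) (den P (set_ireg i (Suc k) s'))"
  shows "Q (ireg s 0) (den (For i P) s)"
proof -
  have "Q k (loop (den P) i k s)" if "k \<le> ireg s 0" for k
    using that
  proof (induction k)
    case (Suc k)
    then show ?case using assms(2)[OF _ agree_off_loop[OF agree_off_den]] by simp
  qed (simp add: assms(1))
  then show ?thesis by simp
qed

section \<open>Execution and running time of compiled commands\<close>

lemma exec_branch:
  "sat b s \<Longrightarrow> exec P s t m s' \<Longrightarrow> \<exists>u. exec (branch b P Q) s u m s' \<and> u \<le> tests b + t"
  "\<not> sat b s \<Longrightarrow> exec Q s t m s' \<Longrightarrow> \<exists>u. exec (branch b P Q) s u m s' \<and> u \<le> tests b + t"
proof (induction b arbitrary: P Q t)
  case (Atom b)
  {
    case 1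
    then show ?case using IfTrue[of b s P t m s' Q] by auto
  next
    case 2
    then show ?case using IfFalse[of b s Q t m s' P] by auto
  }
next
  case (Neg b)
  {
    case 1
    then show ?case using Neg by simp
  next
    case 2
    then show ?case using Neg by simp
  }
next
  case (Conj b c)
  {
    case 1
    then obtain u where u: "exec (branch c P Q) s u m s'" "u \<le> tests c + t"
      using Conj(3) by fastforce
    with Conj(1)[OF _ u(1)] 1 show ?case by fastforce
  next
    case 2
    show ?case
    proof (cases "sat b s")
      case True
      with 2 obtain u where u: "exec (branch c P Q) s u m s'" "u \<le> tests c + t"
        using Conj(4) by fastforce
      with Conj(1)[OF True u(1)] show ?thesis by fastforce
    next
      case False
      with Conj(2)[OF False 2(2)] show ?thesis by fastforce
    qed
  }
next
  case (Disj b c)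
  {
    case 1
    show ?case
    proof (cases "sat b s")
      case True
      with Disj(1)[OF True 1(2)] show ?thesis by fastforce
    next
      case False
      with 1 obtain u where u: "exec (branch c P Q) s u m s'" "u \<le> tests c + t"
        using Disj(3) by fastforce
      with Disj(2)[OF False u(1)] show ?thesis by fastforce
    qed
  next
    case 2
    then obtain u where u: "exec (branch c P Q) s u m s'" "u \<le> tests c + t"
      using Disj(4) by fastforce
    with Disj(2)[OF _ u(1)] 2 show ?case by fastforce
  }
qed

text \<open>\<open>loop f i k s\<close> is the state after \<open>k\<close> rounds. The remaining
  run is built backwards, by induction on \<open>k\<close> down from \<open>n\<close>, where the
  test fails.\<close>

lemma exec_while_loop:
  assumes body: "\<And>s. ireg s 0 = n \<Longrightarrow> \<exists>t m. exec P s t m (f s) \<and> t \<le> T"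
    and unwritten: "\<And>s. ireg (f s) i = ireg s i" "\<And>s. ireg (f s) 0 = ireg s 0"
    and "i \<noteq> 0" "ireg s 0 = n" "k \<le> n"
  shows "\<exists>t m. exec (WHILE (ILess i 0) (SEQ (INSTR (ISuc i)) P)) (loop f i k s) t m (loop f i n s)
    \<and> t \<le> 1 + (n - k) * (2 + T)"
  using \<open>k \<le> n\<close>
proof (induction k rule: inc_induct)
  case base
  have "ireg (loop f i n s) 0 = n" "ireg (loop f i n s) i = n"
    using assms ireg_loop_counter[OF unwritten(1)] by (simp_all add: ireg_loop_unwritten)
  then have "\<not> holds (ILess i 0) (loop f i n s)" by simp
  from WhileFalse[OF this] show ?case by fastforce
next
  case (step k)
  let ?s = "loop f i k s"
  have regs: "ireg ?s 0 = n" "ireg ?s i = k"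
    using assms ireg_loop_counter[OF unwritten(1)] by (simp_all add: ireg_loop_unwritten)
  have "step (ISuc i) ?s = set_ireg i (Suc k) ?s"
    using regs by simp
  moreover obtain t m where t: "exec P (set_ireg i (Suc k) ?s) t m (loop f i (Suc k) s)" "t \<le> T"
    using body[of "set_ireg i (Suc k) ?s"] regs \<open>i \<noteq> 0\<close> by auto
  ultimately obtain m' where body: "exec (SEQ (INSTR (ISuc i)) P) ?s (1 + t) m' (loop f i (Suc k) s)"
    using Seq[OF Instr[of "ISuc i" ?s]] by metis
  obtain u l where u: "exec (WHILE (ILess i 0) (SEQ (INSTR (ISuc i)) P)) (loop f i (Suc k) s) u l (loop f i n s)"
    "u \<le> 1 + (n - Suc k) * (2 + T)"
    using step by auto
  have "holds (ILess i 0) ?s"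
    using regs step by simp
  from WhileTrue[OF this body u(1)] have
    "exec (WHILE (ILess i 0) (SEQ (INSTR (ISuc i)) P)) ?s (1 + (1 + t) + u) (max m' l) (loop f i n s)" .
  moreover have "1 + (1 + t) + u \<le> 1 + (n - k) * (2 + T)"
  proof -
    have "n - k = Suc (n - Suc k)" using step by simp
    then show ?thesis using t(2) u(2) by simp
  qed
  ultimately show ?case by blast
qed

text \<open>As register 0 is never written, all subcommands see the same number of items, and their
  durations can be added.\<close>

lemma exec_compile:
  "loops_ok P \<Longrightarrow> IReg 0 \<notin> writes P \<Longrightarrow>
    \<exists>t m. exec (compile P) s t m (den P s) \<and> t \<le> duration P (ireg s 0)"
proof (induction P arbitrary: s)
  case Pass
  then show ?case using Skip by fastforce
next
  case (Do a)
  then show ?case using Instr by fastforce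
next
  case (Then P Q)
  from Then.IH(1)[of s] Then.prems obtain t m where
    "exec (compile P) s t m (den P s)" "t \<le> duration P (ireg s 0)" by auto
  moreover from Then.IH(2)[of "den P s"] Then.prems obtain t' m' where
    "exec (compile Q) (den P s) t' m' (den Q (den P s))" "t' \<le> duration Q (ireg s 0)"
    by (auto simp: den_unwritten)
  ultimately show ?case
    using Seq by (metis add_mono compile.simps(3) den.simps(3) duration.simps(3))
next
  case (Cond b P Q)
  show ?case
  proof (cases "sat b s")
    case True
    from Cond.IH(1)[of s] Cond.prems obtain t m where
      t: "exec (compile P) s t m (den P s)" "t \<le> duration P (ireg s 0)" by auto
    from exec_branch(1)[OF True t(1)] t(2) True show ?thesis by fastforce
  next
    case False
    from Cond.IH(2)[of s] Cond.prems obtain t m where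
      t: "exec (compile Q) s t m (den Q s)" "t \<le> duration Q (ireg s 0)" by auto
    from exec_branch(2)[OF False t(1)] t(2) False show ?thesis by fastforce
  qed
next
  case (For i P)
  let ?n = "ireg s 0"
  have "\<exists>t m. exec (compile P) s' t m (den P s') \<and> t \<le> duration P ?n" if "ireg s' 0 = ?n" for s'
    using For.IH[of s'] For.prems that by auto
  from exec_while_loop[where f = "den P" and k = 0 and i = i and s = s, OF this] For.prems obtain t m where
    "exec (WHILE (ILess i 0) (SEQ (INSTR (ISuc i)) (compile P))) (set_ireg i 0 s) t m (loop (den P) i ?n s)"
    "t \<le> 1 + ?n * (2 + duration P ?n)"
    by (auto simp: den_unwritten)
  moreover have "exec (INSTR (IConst i 0)) s 1 (max (space s) (space (set_ireg i 0 s))) (set_ireg i 0 s)"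
    using Instr[of "IConst i 0" s] by simp
  ultimately show ?case
    using Seq[of "INSTR (IConst i 0)" s] by fastforce
qed

text \<open>All loops range over the items, so the nesting depth is the degree. The base
  \<open>n + 1\<close> is positive even for \<open>n = 0\<close>, which lets constants be
  absorbed.\<close>

lemma duration_bound: "\<exists>a. \<forall>n. duration P n \<le> a * (n + 1) ^ depth P"
proof (induction P)
  case (Then P Q)
  then obtain a b where ab: "\<And>n. duration P n \<le> a * (n + 1) ^ depth P"
    "\<And>n. duration Q n \<le> b * (n + 1) ^ depth Q" by auto
  have "duration (P ;; Q) n \<le> (a + b) * (n + 1) ^ max (depth P) (depth Q)" for n
  proof -
    have "a * (n + 1) ^ depth P \<le> a * (n + 1) ^ max (depth P) (depth Q)"
      "b * (n + 1) ^ depth Q \<le> b * (n + 1) ^ max (depth P) (depth Q)"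
      by (intro mult_le_mono2 power_increasing; simp)+
    with ab[of n] show ?thesis
      unfolding duration.simps add_mult_distrib by linarith
  qed
  then show ?case by auto
next
  case (Cond b P Q)
  then obtain a a' where ab: "\<And>n. duration P n \<le> a * (n + 1) ^ depth P"
    "\<And>n. duration Q n \<le> a' * (n + 1) ^ depth Q" by auto
  have "duration (Cond b P Q) n \<le> (tests b + a + a') * (n + 1) ^ max (depth P) (depth Q)" for n
  proof -
    have "a * (n + 1) ^ depth P \<le> a * (n + 1) ^ max (depth P) (depth Q)"
      "a' * (n + 1) ^ depth Q \<le> a' * (n + 1) ^ max (depth P) (depth Q)"
      by (intro mult_le_mono2 power_increasing; simp)+
    moreover have "tests b * 1 \<le> tests b * (n + 1) ^ max (depth P) (depth Q)"
      by (intro mult_le_mono2) simp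
    ultimately show ?thesis using ab[of n]
      unfolding duration.simps add_mult_distrib by linarith
  qed
  then show ?case by auto
next
  case (For i P)
  then obtain a where a: "\<And>n. duration P n \<le> a * (n + 1) ^ depth P" by auto
  have "duration (For i P) n \<le> (2 + a) * (n + 1) ^ Suc (depth P)" for n
  proof -
    have one: "1 \<le> (n + 1) ^ depth P" by simp
    have "duration (For i P) n \<le> 2 + n * (2 + a * (n + 1) ^ depth P)"
      using a[of n] by simp
    also have "\<dots> \<le> 2 * (n + 1) ^ depth P + n * (2 * (n + 1) ^ depth P + a * (n + 1) ^ depth P)"
      using one by (intro add_mono mult_le_mono2) auto
    also have "\<dots> \<le> (2 + a) * (n + 1) ^ Suc (depth P)"
      by (simp add: algebra_simps)
    finally show ?thesis .
  qed
  then show ?case unfolding depth.simps by blast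
qed (auto intro: exI[of _ 1])

section \<open>Space of additive programs\<close>

text \<open>Constants are restricted too: 0 is a fraction over every denominator, and an index
  constant up to 1 stays below the bound \<open>Suc N\<close> that holds after the step.\<close>

fun additive_instr :: "instr \<Rightarrow> bool" where
  "additive_instr (IConst r m) \<longleftrightarrow> m \<le> 1"
| "additive_instr (RConst r z) \<longleftrightarrow> z = 0"
| "additive_instr (RArith r f q q') \<longleftrightarrow> f = Plus \<or> f = Minus"
| "additive_instr _ \<longleftrightarrow> True"

fun additive_prog :: "prog \<Rightarrow> bool" where
  "additive_prog SKIP \<longleftrightarrow> True"
| "additive_prog (INSTR a) \<longleftrightarrow> additive_instr a"
| "additive_prog (SEQ P Q) \<longleftrightarrow> additive_prog P \<and> additive_prog Q"
| "additive_prog (IFTE b P Q) \<longleftrightarrow> additive_prog P \<and> additive_prog Q"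
| "additive_prog (WHILE b P) \<longleftrightarrow> additive_prog P"

fun additive :: "cmd \<Rightarrow> bool" where
  "additive Pass \<longleftrightarrow> True"
| "additive (Do a) \<longleftrightarrow> additive_instr a"
| "additive (P ;; Q) \<longleftrightarrow> additive P \<and> additive Q"
| "additive (Cond b P Q) \<longleftrightarrow> additive P \<and> additive Q"
| "additive (For i P) \<longleftrightarrow> additive P"

lemma additive_branch: "additive_prog (branch b P Q) \<longleftrightarrow> additive_prog P \<and> additive_prog Q"
  by (induction b arbitrary: P Q) auto

lemma additive_compile: "additive P \<Longrightarrow> additive_prog (compile P)"
  by (induction P) (auto simp: additive_branch)

text \<open>The fraction is not reduced: \<open>D\<close> stays fixed during a run, so a sum or
  difference costs one bit in the numerator and nothing in the denominator.\<close>

definition bounded_fraction :: "nat \<Rightarrow> nat \<Rightarrow> real \<Rightarrow> bool" where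
  "bounded_fraction D b v \<longleftrightarrow> (\<exists>z::int. v * real D = of_int z \<and> \<bar>z\<bar> < 2 ^ b)"

lemma bounded_fraction_0: "bounded_fraction D b 0"
  by (auto simp: bounded_fraction_def)

lemma bounded_fraction_mono: "bounded_fraction D b v \<Longrightarrow> b \<le> c \<Longrightarrow> bounded_fraction D c v"
  unfolding bounded_fraction_def by (meson one_le_numeral order_less_le_trans power_increasing)

lemma bounded_fraction_arith:
  assumes "bounded_fraction D b v" "bounded_fraction D b w" "f = Plus \<or> f = Minus"
  shows "bounded_fraction D (Suc b) (arith f v w)"
proof -
  obtain y z :: int where yz: "v * real D = of_int y" "\<bar>y\<bar> < 2 ^ b" "w * real D = of_int z" "\<bar>z\<bar> < 2 ^ b"
    using assms unfolding bounded_fraction_def by blast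
  have "(v + w) * real D = of_int (y + z)" "(v - w) * real D = of_int (y - z)"
    using yz by (simp_all add: algebra_simps)
  moreover have "\<bar>y + z\<bar> < 2 ^ Suc b" "\<bar>y - z\<bar> < 2 ^ Suc b"
    using yz by auto
  ultimately show ?thesis
    using assms(3) unfolding bounded_fraction_def by (metis arith.simps(1,2))
qed

lemma The_of_rat: "(THE r. of_rat x = (of_rat r :: real)) = x"
  by (rule the_equality) auto

lemma rat_bits_of_rat:
  "quotient_of r = (p, q) \<Longrightarrow> rat_bits (of_rat r) = 1 + floorlog 2 (nat \<bar>p\<bar>) + floorlog 2 (nat q)"
  by (simp add: rat_bits_def The_of_rat)

text \<open>\<open>rat_bits\<close> measures the reduced fraction p / q, and reduction only shrinks:
  q divides \<open>D\<close> by coprimality, hence p divides z. The 2 pays for the leading 1 in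
  \<open>rat_bits\<close> and for a denominator of \<open>e + 1\<close> bits.\<close>

lemma rat_bits_le:
  assumes "bounded_fraction D b v" "0 < D" "D \<le> 2 ^ e"
  shows "rat_bits v \<le> b + e + 2"
proof -
  obtain z :: int where z: "v * real D = of_int z" "\<bar>z\<bar> < 2 ^ b"
    using assms unfolding bounded_fraction_def by blast
  define r :: rat where "r = of_int z / of_nat D"
  have v: "v = of_rat r"
    using z \<open>0 < D\<close> by (simp add: r_def of_rat_divide field_simps)
  obtain p q where pq: "quotient_of r = (p, q)" by fastforce
  have q: "q > 0" "coprime p q"
    using quotient_of_denom_pos[OF pq] quotient_of_coprime[OF pq] by auto
  have "of_int p / of_int q = (of_int z / of_nat D :: rat)"
    using quotient_of_div[OF pq] r_def by simp
  then have "of_int (p * int D) = (of_int (z * q) :: rat)"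
    using q \<open>0 < D\<close> by (simp add: field_simps)
  then have eq: "p * int D = z * q"
    by (metis of_int_eq_iff)
  have "q dvd int D"
    using q eq by (metis coprime_commute coprime_dvd_mult_right_iff dvd_triv_right)
  then obtain k where k: "int D = q * k" ..
  have "k > 0" using k q \<open>0 < D\<close> by (metis of_nat_0_less_iff zero_less_mult_pos)
  have "z = p * k" using eq k q by auto
  then have "\<bar>p\<bar> \<le> \<bar>z\<bar>" using \<open>k > 0\<close> by (simp add: abs_mult mult_le_cancel_left1)
  then have "nat \<bar>p\<bar> < 2 ^ b"
    using z(2) by (simp add: nat_less_iff)
  then have p_bits: "floorlog 2 (nat \<bar>p\<bar>) \<le> b"
    by (intro floorlog_leI) auto
  have "q \<le> int D" using k \<open>k > 0\<close> q by (simp add: mult_le_cancel_left1)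
  then have "nat q \<le> D" by simp
  also have "D < 2 ^ (e + 1)"
    using assms(3) by (simp add: order_le_less_trans)
  finally have "floorlog 2 (nat q) \<le> e + 1"
    by (intro floorlog_leI) auto
  then show ?thesis
    using p_bits by (simp add: v rat_bits_of_rat[OF pq])
qed

text \<open>Finiteness is demanded separately because \<open>card\<close> is 0 on infinite
  sets.\<close>

definition sparse :: "nat \<Rightarrow> 'a set \<Rightarrow> bool" where
  "sparse N X \<longleftrightarrow> finite X \<and> card X \<le> N"

lemma sparse_mono: "sparse N X \<Longrightarrow> N \<le> N' \<Longrightarrow> sparse N' X"
  by (auto simp: sparse_def)

lemma sparse_insert:
  assumes "sparse N X" "Y \<subseteq> insert p X"
  shows "sparse (Suc N) Y"
proof -
  have "finite (insert p X)" using assms by (simp add: sparse_def)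
  moreover have "card (insert p X) \<le> Suc N"
    using assms(1) by (auto simp: sparse_def card_insert_if)
  ultimately show ?thesis
    using assms(2) unfolding sparse_def by (meson card_mono finite_subset order_trans)
qed

lemma sum_sparse_le:
  assumes "sparse N X" "\<And>x. x \<in> X \<Longrightarrow> f x \<le> (k::nat)"
  shows "sum f X \<le> N * k"
proof -
  have "sum f X \<le> card X * k"
    using sum_bounded_above[of X f k] assms(2) by simp
  then show ?thesis
    using assms(1) unfolding sparse_def by (meson mult_le_mono1 order_trans)
qed

text \<open>A single \<open>N\<close> serves for index values, positions of nonzero cells and
  numbers of nonzero cells, since a step raises each by at most one. Positions are contents of index
  registers and so obey the bound on index values.\<close>

definition compact_state :: "nat \<Rightarrow> nat \<Rightarrow> nat \<Rightarrow> state \<Rightarrow> bool" where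
  "compact_state D b N s \<longleftrightarrow>
     (\<forall>r. ireg s r \<le> N) \<and> (\<forall>a i. iarr s a i \<le> N) \<and>
     (\<forall>r. bounded_fraction D b (rreg s r)) \<and> (\<forall>a i. bounded_fraction D b (rarr s a i)) \<and>
     (\<forall>a i. iarr s a i \<noteq> 0 \<longrightarrow> i \<le> N) \<and> (\<forall>a i. rarr s a i \<noteq> 0 \<longrightarrow> i \<le> N) \<and>
     sparse N {r. ireg s r \<noteq> 0} \<and> sparse N {(a, i). iarr s a i \<noteq> 0} \<and>
     sparse N {r. rreg s r \<noteq> 0} \<and> sparse N {(a, i). rarr s a i \<noteq> 0}"

lemma compact_state_mono:
  "compact_state D b N s \<Longrightarrow> b \<le> b' \<Longrightarrow> N \<le> N' \<Longrightarrow> compact_state D b' N' s"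
  unfolding compact_state_def by (meson bounded_fraction_mono sparse_mono order_trans)

lemma compact_state_step:
  assumes "compact_state D b N s" "additive_instr a"
  shows "compact_state D (Suc b) (Suc N) (step a s)"
proof -
  have s: "compact_state D (Suc b) (Suc N) s"
    using assms(1) by (rule compact_state_mono) auto
  have cells: "\<And>r. ireg s r \<le> N" "\<And>a i. iarr s a i \<le> N"
    "\<And>r. bounded_fraction D b (rreg s r)" "\<And>a i. bounded_fraction D b (rarr s a i)"
    "sparse N {r. ireg s r \<noteq> 0}" "sparse N {(a, i). iarr s a i \<noteq> 0}"
    "sparse N {r. rreg s r \<noteq> 0}" "sparse N {(a, i). rarr s a i \<noteq> 0}"
    using assms(1) by (simp_all add: compact_state_def)
  have ireg: "compact_state D (Suc b) (Suc N) (s\<lparr>ireg := (ireg s)(r := v)\<rparr>)" if "v \<le> Suc N" for r v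
  proof -
    have "sparse (Suc N) {q. ((ireg s)(r := v)) q \<noteq> 0}"
      by (rule sparse_insert[OF cells(5), of _ r]) auto
    then show ?thesis using s that by (auto simp: compact_state_def)
  qed
  have iarr: "compact_state D (Suc b) (Suc N)
      (s\<lparr>iarr := (iarr s)(a := (iarr s a)(ireg s q := ireg s r))\<rparr>)" for a q r
  proof -
    have "sparse (Suc N) {(a', i). ((iarr s)(a := (iarr s a)(ireg s q := ireg s r))) a' i \<noteq> 0}"
      by (rule sparse_insert[OF cells(6), of _ "(a, ireg s q)"]) (auto split: if_splits)
    then show ?thesis using s cells(1) by (auto simp: compact_state_def)
  qed
  have rreg: "compact_state D (Suc b) (Suc N) (s\<lparr>rreg := (rreg s)(r := v)\<rparr>)"
    if "bounded_fraction D (Suc b) v" for r v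
  proof -
    have "sparse (Suc N) {q. ((rreg s)(r := v)) q \<noteq> 0}"
      by (rule sparse_insert[OF cells(7), of _ r]) auto
    then show ?thesis using s that by (auto simp: compact_state_def)
  qed
  have rarr: "compact_state D (Suc b) (Suc N)
      (s\<lparr>rarr := (rarr s)(a := (rarr s a)(ireg s q := rreg s r))\<rparr>)" for a q r
  proof -
    have "sparse (Suc N) {(a', i). ((rarr s)(a := (rarr s a)(ireg s q := rreg s r))) a' i \<noteq> 0}"
      by (rule sparse_insert[OF cells(8), of _ "(a, ireg s q)"]) (auto split: if_splits)
    then show ?thesis using s cells(1) by (auto simp: compact_state_def)
  qed
  have ivals: "ireg s q \<le> Suc N" "iarr s a i \<le> Suc N" "ireg s q + 1 \<le> Suc N" "ireg s q - 1 \<le> Suc N" for q a i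
    using cells(1)[of q] cells(2)[of a i] by auto
  have rvals: "bounded_fraction D (Suc b) (rarr s a i)" for a i
    using s by (simp add: compact_state_def)
  show ?thesis
    using assms(2)
    by (cases a) (auto intro!: ireg iarr rreg rarr ivals rvals bounded_fraction_0
        bounded_fraction_arith cells(3) simp del: arith.simps One_nat_def)
qed

text \<open>The four sums of \<open>space\<close> in order, with at most \<open>N\<close> cells
  each. Charging \<open>N\<close> bits for a natural number up to \<open>N\<close> is generous but
  polynomial.\<close>

definition space_bound :: "nat \<Rightarrow> nat \<Rightarrow> nat \<Rightarrow> nat" where
  "space_bound e b N = N * N + N * (N + N) + N * (b + e + 2) + N * (N + (b + e + 2))"

lemma space_bound_mono: "b \<le> b' \<Longrightarrow> N \<le> N' \<Longrightarrow> space_bound e b N \<le> space_bound e b' N'"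
  unfolding space_bound_def by (intro add_mono mult_le_mono) auto

lemma floorlog_2_le: "i \<le> N \<Longrightarrow> floorlog 2 i \<le> N"
  by (rule floorlog_leI) (auto intro: order_le_less_trans[OF _ less_exp])

lemma space_le:
  assumes "compact_state D b N s" "0 < D" "D \<le> 2 ^ e"
  shows "space s \<le> space_bound e b N"
  unfolding space_def space_bound_def
proof (intro add_mono sum_sparse_le)
  have bits: "rat_bits (rreg s r) \<le> b + e + 2" "rat_bits (rarr s a i) \<le> b + e + 2" for r a i
    using assms by (auto simp: compact_state_def intro!: rat_bits_le simp del: add_2_eq_Suc')
  show "rat_bits (rreg s r) \<le> b + e + 2" for r
    by (rule bits)
  show "(case p of (a, i) \<Rightarrow> floorlog 2 i + rat_bits (rarr s a i)) \<le> N + (b + e + 2)"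
    if "p \<in> {(a, i). rarr s a i \<noteq> 0}" for p
    using that assms(1) bits
    by (auto simp: compact_state_def intro!: add_mono floorlog_2_le simp del: add_2_eq_Suc')
qed (use assms in \<open>auto simp: compact_state_def intro!: add_mono floorlog_2_le\<close>)

text \<open>Each unit of time raises both bounds by at most one, so the elapsed time can be added to
  them. Monotonicity of \<open>space_bound\<close> covers the intermediate states.\<close>

lemma exec_compact:
  assumes "0 < D" "D \<le> 2 ^ e"
  shows "exec P s t m s' \<Longrightarrow> additive_prog P \<Longrightarrow> compact_state D b N s \<Longrightarrow>
    compact_state D (b + t) (N + t) s' \<and> m \<le> space_bound e (b + t) (N + t)"
proof (induction arbitrary: b N rule: exec.induct)
  case (Skip s)
  then show ?case
    using compact_state_mono[of D b N s "b + 1" "N + 1"] space_le[OF _ assms] by simp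
next
  case (Instr c s)
  have "compact_state D (b + 1) (N + 1) s" "compact_state D (b + 1) (N + 1) (step c s)"
    using Instr compact_state_mono[of D b N s "b + 1" "N + 1"] compact_state_step by auto
  then show ?case
    using space_le[OF _ assms] by auto
next
  case (Seq P s t m s' Q t' m' s'')
  have "compact_state D (b + t) (N + t) s'" "m \<le> space_bound e (b + t) (N + t)"
    using Seq by auto
  moreover from this have "compact_state D (b + t + t') (N + t + t') s''"
    "m' \<le> space_bound e (b + t + t') (N + t + t')"
    using Seq by auto
  moreover have "space_bound e (b + t) (N + t) \<le> space_bound e (b + t + t') (N + t + t')"
    by (rule space_bound_mono) auto
  ultimately show ?case by (simp add: add.assoc)
next
  case (IfTrue c s P t m s' Q)
  then have "compact_state D (b + t) (N + t) s'" "m \<le> space_bound e (b + t) (N + t)"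
    by auto
  then show ?case
    using compact_state_mono[of D "b + t" "N + t" s' "b + (1 + t)" "N + (1 + t)"]
      space_bound_mono[of "b + t" "b + (1 + t)" "N + t" "N + (1 + t)" e] by auto
next
  case (IfFalse c s Q t m s' P)
  then have "compact_state D (b + t) (N + t) s'" "m \<le> space_bound e (b + t) (N + t)"
    by auto
  then show ?case
    using compact_state_mono[of D "b + t" "N + t" s' "b + (1 + t)" "N + (1 + t)"]
      space_bound_mono[of "b + t" "b + (1 + t)" "N + t" "N + (1 + t)" e] by auto
next
  case (WhileFalse c s P)
  then show ?case
    using compact_state_mono[of D b N s "b + 1" "N + 1"] space_le[OF _ assms] by simp
next
  case (WhileTrue c s P t m s' t' m' s'')
  have "compact_state D (b + t) (N + t) s'" "m \<le> space_bound e (b + t) (N + t)"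
    using WhileTrue by auto
  moreover from this have "compact_state D (b + t + t') (N + t + t') s''"
    "m' \<le> space_bound e (b + t + t') (N + t + t')"
    using WhileTrue by auto
  moreover have "space_bound e (b + t) (N + t) \<le> space_bound e (b + (1 + t + t')) (N + (1 + t + t'))"
    "space_bound e (b + t + t') (N + t + t') \<le> space_bound e (b + (1 + t + t')) (N + (1 + t + t'))"
    by (rule space_bound_mono; simp)+
  ultimately show ?case
    using compact_state_mono[of D "b + t + t'" "N + t + t'" s'' "b + (1 + t + t')" "N + (1 + t + t')"]
    by auto
qed

section \<open>Compactness of the initial state, and the resulting polynomial bounds\<close>

lemma part_unique:
  assumes "valid_instance I" "j \<in> {1..num_parts I}" "i \<in> part I j" "k \<in> {1..num_parts I}" "i \<in> part I k"
  shows "j = k"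
  using assms unfolding valid_instance_def disjoint_family_on_def by blast

lemma part_index_eq:
  assumes "valid_instance I" "j \<in> {1..num_parts I}" "i \<in> part I j"
  shows "part_index I i = j"
  unfolding part_index_def
proof (rule the_equality)
  show "k = j" if "k \<in> {1..num_parts I} \<and> i \<in> part I k" for k
    using part_unique[OF assms(1)] assms(2,3) that by blast
qed (use assms in blast)

lemma valid_part_index:
  assumes "valid_instance I" "i \<in> items I"
  shows "part_index I i \<in> {1..num_parts I}" "i \<in> part I (part_index I i)"
proof -
  obtain j where j: "j \<in> {1..num_parts I}" "i \<in> part I j"
    using assms unfolding valid_instance_def by blast
  then show "part_index I i \<in> {1..num_parts I}" "i \<in> part I (part_index I i)"
    using part_index_eq[OF assms(1) j] by simp_all
qed

text \<open>\<open>compact_state\<close> bounds index registers by value, whereas the encoding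
  length contains only the bit length of the number of parts.\<close>

lemma num_parts_le:
  assumes "I \<in> two_item_instances"
  shows "num_parts I \<le> num_items I"
proof -
  have I: "valid_instance I" "\<And>j. j \<in> {1..num_parts I} \<Longrightarrow> card (part I j) = 2"
    using assms by (auto simp: two_item_instances_def)
  have "card (items I) = (\<Sum>j\<in>{1..num_parts I}. card (part I j))"
  proof -
    have "finite (part I j)" if "j \<in> {1..num_parts I}" for j
      using I(2)[OF that] by (metis card.infinite zero_neq_numeral)
    moreover have "items I = (\<Union>j\<in>{1..num_parts I}. part I j)"
      using I(1) by (simp add: valid_instance_def)
    moreover have "disjoint_family_on (part I) {1..num_parts I}"
      using I(1) by (simp add: valid_instance_def)
    ultimately show ?thesis
      by (subst card_UN_disjoint'[symmetric]) auto
  qed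
  also have "\<dots> = 2 * num_parts I"
    using I(2) by simp
  finally show ?thesis by (simp add: items_def)
qed

definition denominator :: "real \<Rightarrow> nat" where
  "denominator x = nat (snd (quotient_of (THE r. x = of_rat r)))"

text \<open>The bound \<open>2 * e\<close> arises because the numerator over \<open>D\<close> is the
  reduced numerator times a cofactor of \<open>D\<close>, and neither exceeds
  \<open>2 ^ e\<close>.\<close>

lemma denominator:
  assumes "x \<in> \<rat>"
  shows "0 < denominator x" "denominator x \<le> 2 ^ rat_bits x"
    "denominator x dvd D \<Longrightarrow> 0 < D \<Longrightarrow> D \<le> 2 ^ e \<Longrightarrow> rat_bits x \<le> e \<Longrightarrow> bounded_fraction D (2 * e) x"
proof -
  obtain r where r: "x = of_rat r" using assms by (auto elim: Rats_cases)
  obtain p q where pq: "quotient_of r = (p, q)" by fastforce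
  have q: "q > 0" using quotient_of_denom_pos[OF pq] .
  have den: "denominator x = nat q"
    by (simp add: denominator_def r The_of_rat pq)
  have bits: "rat_bits x = 1 + floorlog 2 (nat \<bar>p\<bar>) + floorlog 2 (nat q)"
    using rat_bits_of_rat[OF pq] r by simp
  have less: "a < 2 ^ floorlog 2 a" for a
    by (cases "a = 0") (auto simp: floorlog_bounds)
  show "0 < denominator x" using q den by simp
  have "nat q \<le> 2 ^ floorlog 2 (nat q)" using less less_imp_le by blast
  also have "\<dots> \<le> 2 ^ rat_bits x" unfolding bits by (intro power_increasing) auto
  finally show "denominator x \<le> 2 ^ rat_bits x" using den by simp
  assume D: "denominator x dvd D" "0 < D" "D \<le> 2 ^ e" "rat_bits x \<le> e"
  then obtain k where k: "D = nat q * k" using den by auto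
  have x: "x = of_int p / of_int q"
    using quotient_of_div[OF pq] r by (simp add: of_rat_divide)
  have "x * real D = of_int (p * int k)"
    using q by (simp add: x k)
  moreover have "\<bar>p * int k\<bar> < 2 ^ (2 * e)"
  proof -
    have "1 \<le> nat q" using q by simp
    then have "k \<le> D" using mult_le_mono1[of 1 "nat q" k] k by simp
    then have "k \<le> 2 ^ e" using D(3) by linarith
    have "nat \<bar>p\<bar> < 2 ^ floorlog 2 (nat \<bar>p\<bar>)" by (rule less)
    also have "\<dots> \<le> 2 ^ e" using bits D(4) by (intro power_increasing) auto
    finally have "nat \<bar>p\<bar> * k < 2 ^ e * 2 ^ e"
    proof (rule mult_less_le_imp_less)
      show "0 < k" using D(2) k by (cases k) auto
    qed (use \<open>k \<le> 2 ^ e\<close> in auto)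
    then have "int (nat \<bar>p\<bar> * k) < int (2 ^ e * 2 ^ e)"
      by (simp only: of_nat_less_iff)
    then show ?thesis by (simp add: abs_mult mult_2 power_add)
  qed
  ultimately show "bounded_fraction D (2 * e) x"
    unfolding bounded_fraction_def by blast
qed

text \<open>Every item is charged, since \<open>rat_bits\<close> is at least 1 even for the number
  0.\<close>

lemma num_items_le_encoding_length: "num_items I \<le> encoding_length I"
proof -
  have "num_items I = (\<Sum>i\<in>items I. 1)" by (simp add: items_def)
  also have "\<dots> \<le> (\<Sum>i\<in>items I. floorlog 2 (part_index I i) +
        rat_bits (first_cost I i) + rat_bits (base_cost I i) + rat_bits (deviation I i))"
    by (intro sum_mono) (simp add: rat_bits_def split: prod.split)
  also have "\<dots> \<le> encoding_length I" by (simp add: encoding_length_def)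
  finally show ?thesis .
qed

text \<open>\<open>3 * E + 2\<close> has room for the nonzero cells of three real arrays with at
  most \<open>E\<close> items each, and for the two index registers that hold input.\<close>

lemma compact_state_initial:
  assumes "I \<in> two_item_instances" "rational_instance I"
  defines "E \<equiv> encoding_length I"
  obtains D where "0 < D" "D \<le> 2 ^ E" "compact_state D (2 * E) (3 * E + 2) (initial I)"
proof -
  let ?d = "\<lambda>i. denominator (first_cost I i) * denominator (base_cost I i) * denominator (deviation I i)"
  let ?b = "\<lambda>i. rat_bits (first_cost I i) + rat_bits (base_cost I i) + rat_bits (deviation I i)"
  \<comment> \<open>The product of all denominators suffices as common denominator: its bit length
    is controlled by the sum of the bit lengths of the costs.\<close>
  define D where "D = prod ?d (items I)"
  have rat: "first_cost I i \<in> \<rat>" "base_cost I i \<in> \<rat>" "deviation I i \<in> \<rat>" if "i \<in> items I" for i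
    using that assms(2) by (auto simp: rational_instance_def)
  have fin: "finite (items I)" by (simp add: items_def)
  have "D > 0"
    unfolding D_def using rat by (intro prod_pos) (auto intro!: denominator(1))
  have sum_b: "sum ?b (items I) \<le> E"
  proof -
    have "sum ?b (items I) \<le> (\<Sum>i\<in>items I. floorlog 2 (part_index I i) +
        rat_bits (first_cost I i) + rat_bits (base_cost I i) + rat_bits (deviation I i))"
      by (intro sum_mono) auto
    then show ?thesis by (simp add: E_def encoding_length_def)
  qed
  have "D \<le> (\<Prod>i\<in>items I. 2 ^ ?b i)"
    unfolding D_def power_add by (intro prod_mono conjI mult_le_mono denominator(2) rat) auto
  also have "\<dots> = 2 ^ sum ?b (items I)" by (simp add: power_sum)
  also have "\<dots> \<le> 2 ^ E" using sum_b by (intro power_increasing) auto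
  finally have "D \<le> 2 ^ E" .
  have frac: "bounded_fraction D (2 * E) (first_cost I i)" "bounded_fraction D (2 * E) (base_cost I i)"
    "bounded_fraction D (2 * E) (deviation I i)" if i: "i \<in> items I" for i
  proof -
    have "?d i dvd D" unfolding D_def using fin i by (rule dvd_prodI)
    then have dvd: "denominator (first_cost I i) dvd D" "denominator (base_cost I i) dvd D"
      "denominator (deviation I i) dvd D"
      by (meson dvd_mult_left dvd_mult_right)+
    have "?b i \<le> sum ?b (items I)" using fin i by (intro member_le_sum) auto
    then have "?b i \<le> E" using sum_b by linarith
    then have "rat_bits (first_cost I i) \<le> E" "rat_bits (base_cost I i) \<le> E"
      "rat_bits (deviation I i) \<le> E" by auto
    with dvd \<open>D > 0\<close> \<open>D \<le> 2 ^ E\<close> rat[OF i]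
    show "bounded_fraction D (2 * E) (first_cost I i)" "bounded_fraction D (2 * E) (base_cost I i)"
      "bounded_fraction D (2 * E) (deviation I i)"
      by (auto intro!: denominator(3))
  qed
  have n: "num_items I \<le> E" unfolding E_def by (rule num_items_le_encoding_length)
  have K: "num_parts I \<le> E" using num_parts_le[OF assms(1)] n by simp
  have part: "part_index I i \<le> E" if "i \<in> items I" for i
    using valid_part_index(1)[OF _ that] assms(1) K by (fastforce simp: two_item_instances_def)
  have item_le: "i \<le> E" if "i \<in> items I" for i
    using that n by (simp add: items_def)
  have sparse_cells: "sparse (3 * E + 2) X" if "X \<subseteq> {0, 1, 2} \<times> items I" for X :: "(nat \<times> nat) set"
  proof -
    have "card X \<le> card ({0, 1, 2 :: nat} \<times> items I)"
      using that fin by (intro card_mono) auto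
    also have "\<dots> = 3 * num_items I" by (simp add: card_cartesian_product items_def)
    finally show ?thesis
      using n that fin unfolding sparse_def by (auto intro: finite_subset)
  qed
  have sparse_regs: "sparse (3 * E + 2) X" if "X \<subseteq> {0, 1}" for X :: "nat set"
  proof -
    have "card X \<le> card {0, 1 :: nat}"
      using that by (intro card_mono) auto
    then show ?thesis
      using that unfolding sparse_def by (auto intro: finite_subset)
  qed
  have "compact_state D (2 * E) (3 * E + 2) (initial I)"
    unfolding compact_state_def
  proof (intro conjI)
    show "\<forall>r. ireg (initial I) r \<le> 3 * E + 2" "\<forall>a i. iarr (initial I) a i \<le> 3 * E + 2"
      using n K part by (fastforce simp: initial_def)+
    show "\<forall>r. bounded_fraction D (2 * E) (rreg (initial I) r)"
      "\<forall>a i. bounded_fraction D (2 * E) (rarr (initial I) a i)"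
      using frac by (auto simp: initial_def bounded_fraction_0)
    show "\<forall>a i. iarr (initial I) a i \<noteq> 0 \<longrightarrow> i \<le> 3 * E + 2"
      "\<forall>a i. rarr (initial I) a i \<noteq> 0 \<longrightarrow> i \<le> 3 * E + 2"
      using item_le by (fastforce simp: initial_def split: if_splits)+
    show "sparse (3 * E + 2) {r. ireg (initial I) r \<noteq> 0}"
      "sparse (3 * E + 2) {r. rreg (initial I) r \<noteq> 0}"
      by (rule sparse_regs; auto simp: initial_def split: if_splits)+
    show "sparse (3 * E + 2) {(a, i). iarr (initial I) a i \<noteq> 0}"
      "sparse (3 * E + 2) {(a, i). rarr (initial I) a i \<noteq> 0}"
      by (rule sparse_cells; auto simp: initial_def split: if_splits)+
  qed
  with \<open>D > 0\<close> \<open>D \<le> 2 ^ E\<close> show ?thesis by (rule that)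
qed

lemma exec_initial:
  assumes "loops_ok P" "IReg 0 \<notin> writes P"
  shows "\<exists>t m. exec (compile P) (initial I) t m (den P (initial I)) \<and> t \<le> duration P (num_items I)"
  using exec_compile[OF assms, of "initial I"] by (simp add: initial_def)

text \<open>A program that only adds and subtracts at most doubles the numerators over a common
  denominator of the input in each step. Hence polynomial space follows from polynomial time.\<close>

lemma strongly_polynomial_compile:
  assumes "loops_ok P" "IReg 0 \<notin> writes P" "additive P"
  shows "strongly_polynomial (compile P) two_item_instances"
proof -
  obtain a where a: "\<And>n. duration P n \<le> a * (n + 1) ^ depth P"
    using duration_bound by blast
  define T where "T = smult a ([:1, 1:] ^ depth P)"
  have T: "poly T n = a * (n + 1) ^ depth P" for n
    by (simp add: T_def poly_power)
  have T_mono: "poly T n \<le> poly T n'" if "n \<le> n'" for n n'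
    unfolding T using that by (intro mult_le_mono2 power_mono) auto
  have "time_bounded (compile P) two_item_instances (poly T)"
    unfolding time_bounded_def T
  proof
    fix I
    obtain t m where "exec (compile P) (initial I) t m (den P (initial I))"
      "t \<le> duration P (num_items I)"
      using exec_initial[OF assms(1,2)] by blast
    with a[of "num_items I"] show
      "\<exists>t m s. exec (compile P) (initial I) t m s \<and> t \<le> a * (num_items I + 1) ^ depth P"
      by (meson order_trans)
  qed
  moreover
  \<comment> \<open>\<open>B\<close> and \<open>N\<close> are the bounds 2E + T(E) and 3E + 2 + T(E)
    as polynomials in E, and \<open>q\<close> repeats \<open>space_bound\<close> for them with
    exponent E.\<close>
  define X where "X = (monom 1 1 :: nat poly)"
  define B where "B = smult 2 X + T"
  define N where "N = smult 3 X + [:2:] + T"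
  define q where "q = N * N + N * (N + N) + N * (B + X + [:2:]) + N * (N + (B + X + [:2:]))"
  have q: "poly q E = space_bound E (2 * E + poly T E) (3 * E + 2 + poly T E)" for E
    by (simp add: q_def N_def B_def X_def space_bound_def poly_monom algebra_simps)
  have "space_bounded (compile P) two_item_instances (poly q)"
    unfolding space_bounded_def
  proof (intro ballI impI)
    fix I assume I: "I \<in> two_item_instances" "rational_instance I"
    let ?E = "encoding_length I"
    obtain t m where t: "exec (compile P) (initial I) t m (den P (initial I))"
      "t \<le> duration P (num_items I)"
      using exec_initial[OF assms(1,2)] by blast
    have "t \<le> poly T ?E"
      using t(2) a[of "num_items I"] T_mono[OF num_items_le_encoding_length[of I]] T[of "num_items I"]
      by linarith
    obtain D where D: "0 < D" "D \<le> 2 ^ ?E" "compact_state D (2 * ?E) (3 * ?E + 2) (initial I)"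
      using compact_state_initial[OF I] .
    have "m \<le> space_bound ?E (2 * ?E + t) (3 * ?E + 2 + t)"
      using exec_compact[OF D(1,2) t(1) additive_compile[OF assms(3)] D(3)] by blast
    also have "\<dots> \<le> poly q ?E"
      unfolding q using \<open>t \<le> poly T ?E\<close> by (intro space_bound_mono) auto
    finally show "\<exists>t m s. exec (compile P) (initial I) t m s \<and> m \<le> poly q ?E"
      using t(1) by blast
  qed
  ultimately show ?thesis
    unfolding strongly_polynomial_def by blast
qed

lemma time_bounded_compile:
  assumes "loops_ok P" "IReg 0 \<notin> writes P" "depth P \<le> d"
  shows "\<exists>f. time_bounded (compile P) A f \<and> (\<lambda>n. real (f n)) \<in> O(\<lambda>n. real n ^ d)"
proof -
  obtain a where a: "\<And>n. duration P n \<le> a * (n + 1) ^ depth P"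
    using duration_bound by blast
  define f where "f n = a * (n + 1) ^ d" for n
  have "time_bounded (compile P) A f"
    unfolding time_bounded_def
  proof
    fix I
    obtain t m where "exec (compile P) (initial I) t m (den P (initial I))"
      "t \<le> duration P (num_items I)"
      using exec_initial[OF assms(1,2)] by blast
    moreover have "a * (num_items I + 1) ^ depth P \<le> f (num_items I)"
      unfolding f_def using assms(3) by (intro mult_le_mono2 power_increasing) auto
    ultimately show "\<exists>t m s. exec (compile P) (initial I) t m s \<and> t \<le> f (num_items I)"
      using a[of "num_items I"] by (meson order_trans)
  qed
  moreover have "(\<lambda>n. real (f n)) \<in> O(\<lambda>n. real n ^ d)"
  \<comment> \<open>The factor \<open>2 ^ d\<close> comes from n + 1 \<le> 2n for n \<ge> 1.\<close>
  proof (rule bigoI[of _ "real a * 2 ^ d"])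
    have "norm (real (f n)) \<le> real a * 2 ^ d * norm (real n ^ d)" if "n \<ge> 1" for n
    proof -
      have "f n \<le> a * (2 * n) ^ d"
        unfolding f_def using that by (intro mult_le_mono2 power_mono) auto
      then have "real (f n) \<le> real (a * (2 * n) ^ d)" by (simp only: of_nat_le_iff)
      then show ?thesis by (simp add: power_mult_distrib mult.assoc)
    qed
    then show "\<forall>\<^sub>F n in sequentially. norm (real (f n)) \<le> real a * 2 ^ d * norm (real n ^ d)"
      unfolding eventually_sequentially by blast
  qed
  ultimately show ?thesis by blast
qed

section \<open>Guessing the cheapest swap and the adversarial cost\<close>

text \<open>The combinatorics sees the parts only through a fixed-point-free involution.\<close>

locale pairing =
  fixes n :: nat and \<sigma> :: "nat \<Rightarrow> nat" and C c d :: "nat \<Rightarrow> real"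
  assumes partner_item: "i \<in> {1..n} \<Longrightarrow> \<sigma> i \<in> {1..n}"
    and partner_neq: "i \<in> {1..n} \<Longrightarrow> \<sigma> i \<noteq> i"
    and partner_partner: "i \<in> {1..n} \<Longrightarrow> \<sigma> (\<sigma> i) = i"
    and dev_nonneg: "i \<in> {1..n} \<Longrightarrow> 0 \<le> d i"
begin

definition selection :: "nat set \<Rightarrow> bool" where
  "selection S \<longleftrightarrow> S \<subseteq> {1..n} \<and> (\<forall>i\<in>{1..n}. i \<in> S \<longleftrightarrow> \<sigma> i \<notin> S)"

definition swap :: "nat \<Rightarrow> nat set \<Rightarrow> nat set" where
  "swap l S = insert (\<sigma> l) (S - {l})"

definition recoveries :: "nat set \<Rightarrow> nat set set" where
  "recoveries S = insert S ((\<lambda>l. swap l S) ` S)"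

definition attacks :: "nat set set" where
  "attacks = insert {} ((\<lambda>q. {q}) ` {1..n})"

definition attacked :: "nat set \<Rightarrow> nat \<Rightarrow> real" where
  "attacked D i = c i + (if i \<in> D then d i else 0)"

definition total :: "nat \<Rightarrow> real" where
  "total i = C i + c i"

definition gain :: "nat \<Rightarrow> real" where
  "gain i = c (\<sigma> i) - c i"

text \<open>If the recovery may stay, swap \<open>e\<close>, or swap the attacked item, then \<open>attack_bound e j\<close> is
  its cost relative to no attack when \<open>j \<noteq> e\<close> is attacked.\<close>

definition attack_bound :: "nat \<Rightarrow> nat \<Rightarrow> real" where
  "attack_bound e j = min (gain j) (d j + min 0 (gain e))"

text \<open>The worst of no attack, an attack on \<open>e\<close> and an attack on \<open>\<sigma> e\<close>, where \<open>z \<le> 0\<close> is the cost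
  of the best recovery that does not touch the pair of \<open>e\<close>.\<close>

definition pair_bound :: "nat \<Rightarrow> real \<Rightarrow> real" where
  "pair_bound e z =
     max (max (min (gain e) (d e + z)) (min z (gain e + d (\<sigma> e)))) (min 0 (gain e))"

text \<open>\<open>r = e\<close> encodes staying as the only fallback, at relative cost 0. For other
  \<open>r\<close> staying remains possible, hence the minimum with 0.\<close>

definition fallback_bound :: "nat \<Rightarrow> nat \<Rightarrow> real" where
  "fallback_bound e r = pair_bound e (if r = e then 0 else min 0 (gain r))"

text \<open>Neither \<open>e\<close> nor \<open>r\<close> has to be a cheapest swap. They merely
  name recoveries that are available, which suffices to answer every attack within
  \<open>t\<close>.\<close>

definition certified :: "nat \<Rightarrow> real \<Rightarrow> nat set set" where
  "certified e t = {S. selection S \<and> e \<in> S \<and> (\<forall>j\<in>S. attack_bound e j \<le> t) \<and>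
     (\<exists>r\<in>S. fallback_bound e r \<le> t)}"

lemma selection_finite: "selection S \<Longrightarrow> finite S"
  unfolding selection_def by (meson finite_atLeastAtMost finite_subset)

lemma selection_item: "selection S \<Longrightarrow> i \<in> S \<Longrightarrow> i \<in> {1..n}"
  unfolding selection_def by blast

lemma selection_partner: "selection S \<Longrightarrow> i \<in> {1..n} \<Longrightarrow> i \<in> S \<longleftrightarrow> \<sigma> i \<notin> S"
  unfolding selection_def by blast

lemma partner_eq_iff: "i \<in> {1..n} \<Longrightarrow> j \<in> {1..n} \<Longrightarrow> \<sigma> i = \<sigma> j \<longleftrightarrow> i = j"
  by (metis partner_partner)

lemma sum_swap:
  assumes "selection S" "l \<in> S"
  shows "sum f (swap l S) = sum f S - f l + (f (\<sigma> l) :: real)"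
proof -
  have "\<sigma> l \<notin> S"
    using assms selection_partner selection_item by blast
  then show ?thesis
    using assms selection_finite[OF assms(1)] unfolding swap_def
    by (subst sum.insert) (auto simp: sum_diff1)
qed

lemma sum_attacked:
  assumes "selection S"
  shows "sum (attacked {}) S = sum c S"
    "sum (attacked {q}) S = sum c S + (if q \<in> S then d q else 0)"
  using selection_finite[OF assms] by (auto simp: attacked_def sum.distrib)

lemma attacked_swap:
  assumes "selection S" "l \<in> S"
  shows "sum (attacked {}) (swap l S) = sum c S + gain l"
    "sum (attacked {q}) (swap l S) =
       sum c S + gain l + (if q \<in> S \<and> q \<noteq> l then d q else 0) + (if q = \<sigma> l then d q else 0)"
proof -
  have "\<sigma> l \<noteq> l" using assms selection_item partner_neq by blast
  moreover have "\<sigma> l \<notin> S" using assms selection_partner selection_item by blast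
  ultimately show "sum (attacked {}) (swap l S) = sum c S + gain l"
    "sum (attacked {q}) (swap l S) =
       sum c S + gain l + (if q \<in> S \<and> q \<noteq> l then d q else 0) + (if q = \<sigma> l then d q else 0)"
    using assms(2) unfolding sum_swap[OF assms] sum_attacked[OF assms(1)]
    by (auto simp: attacked_def gain_def)
qed

text \<open>Staying and swapping \<open>e\<close>, \<open>r\<close> or the attacked item
  \<open>q\<close> are the only recoveries used. If all of them exceeded the bound, then the
  position of \<open>q\<close> relative to \<open>S\<close> and to the pair of \<open>e\<close>
  would determine which condition of \<open>certified\<close> fails.\<close>

lemma certified_recovery:
  assumes "S \<in> certified e t" "D \<in> attacks"
  shows "\<exists>S'\<in>recoveries S. sum (attacked D) S' \<le> sum c S + t"
proof (rule ccontr)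
  assume "\<not> ?thesis"
  then have bad: "sum c S + t < sum (attacked D) S'" if "S' \<in> recoveries S" for S'
    using that by force
  obtain r where S: "selection S" "e \<in> S" "\<And>j. j \<in> S \<Longrightarrow> attack_bound e j \<le> t"
    and r: "r \<in> S" "fallback_bound e r \<le> t"
    using assms(1) by (auto simp: certified_def)
  have e: "e \<in> {1..n}" using S selection_item by blast
  have "min 0 (gain e) \<le> t" using r(2) by (simp add: fallback_bound_def pair_bound_def)
  have stay: "sum c S + t < sum (attacked D) S"
    and swap: "\<And>l. l \<in> S \<Longrightarrow> sum c S + t < sum (attacked D) (swap l S)"
    using bad by (auto simp: recoveries_def)
  consider "D = {}" | q where "q \<in> {1..n}" "D = {q}"
    using assms(2) by (auto simp: attacks_def)
  then show False
  proof cases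
    case 1
    then show False
      using stay swap[OF S(2)] \<open>min 0 (gain e) \<le> t\<close>
      by (simp add: sum_attacked[OF S(1)] attacked_swap[OF S(1)] S(2) min_def split: if_splits)
  next
    case (2 q)
    note costs = sum_attacked[OF S(1)] attacked_swap[OF S(1)]
    have stay: "t < (if q \<in> S then d q else 0)"
      using stay by (simp add: 2 costs)
    have swap: "t < gain l + (if q \<in> S \<and> q \<noteq> l then d q else 0) + (if q = \<sigma> l then d q else 0)"
      if "l \<in> S" for l
      using swap[OF that] that by (simp add: 2 costs)
    have partner: "\<sigma> l \<notin> S" if "l \<in> S" for l
      using that S(1) selection_partner selection_item by blast
    let ?z = "if r = e then 0 else min 0 (gain r)"
    have r_e: "r \<noteq> e \<Longrightarrow> \<sigma> r \<noteq> \<sigma> e"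
      using r(1) e S(1) selection_item partner_eq_iff by blast
    have pair: "min (gain e) (d e + ?z) \<le> t" "min ?z (gain e + d (\<sigma> e)) \<le> t"
      using r(2) by (simp_all add: fallback_bound_def pair_bound_def)
    consider "q = e" | "q \<in> S" "q \<noteq> e" | "q \<notin> S" "q = \<sigma> e" | "q \<notin> S" "q \<noteq> \<sigma> e"
      by blast
    then show False
    proof cases
      case 1
      have "q \<noteq> \<sigma> l" if "l \<in> S" for l using partner[OF that] 1 S(2) by blast
      then have "t < d e" "t < gain e" "r \<noteq> e \<Longrightarrow> t < gain r + d e"
        using stay swap[OF S(2)] swap[OF r(1)] 1 S(2) r(1) by auto
      then show False using pair(1) by (auto simp: min_def split: if_splits)
    next
      case 2
      have "q \<noteq> \<sigma> l" if "l \<in> S" for l using partner[OF that] 2 by blast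
      then have "t < d q" "t < gain q" "t < gain e + d q"
        using stay swap[OF S(2)] swap[OF 2(1)] 2 S(2) by auto
      then show False using S(3)[OF 2(1)] by (auto simp: attack_bound_def min_def split: if_splits)
    next
      case 3
      then have "t < 0" "t < gain e + d (\<sigma> e)" "r \<noteq> e \<Longrightarrow> t < gain r"
        using stay swap[OF S(2)] swap[OF r(1)] r_e by auto
      then show False using pair(2) by (auto simp: min_def split: if_splits)
    next
      \<comment> \<open>This attack affects neither staying nor swapping \<open>e\<close>, so it is
        answered like no attack.\<close>
      case 4
      then have "t < 0" "t < gain e"
        using stay swap[OF S(2)] by auto
      then show False using \<open>min 0 (gain e) \<le> t\<close> by auto
    qed
  qed
qed

text \<open>For the cheapest \<open>e\<close> and \<open>r\<close>, every bound in
  \<open>certified\<close> is also a lower bound: some attack enforces it against all recoveries.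
  The maximum of these finitely many bounds certifies \<open>S\<close>, and an attack that enforces
  the maximum shows that it is not too large.\<close>

lemma exists_certificate:
  assumes S: "selection S" and "n > 0"
  shows "\<exists>e\<in>{1..n}. \<exists>i\<in>{1..n}. \<exists>t\<in>{attack_bound e i, fallback_bound e i}. S \<in> certified e t \<and>
    (\<exists>D\<in>attacks. \<forall>S'\<in>recoveries S. sum c S + t \<le> sum (attacked D) S')"
proof -
  note fin = selection_finite[OF S]
  note costs = sum_attacked[OF S] attacked_swap[OF S]
  have "1 \<in> S \<or> \<sigma> 1 \<in> S" using selection_partner[OF S, of 1] \<open>n > 0\<close> by auto
  then have "S \<noteq> {}" by blast
  obtain e where e: "e \<in> S" "\<And>l. l \<in> S \<Longrightarrow> gain e \<le> gain l"
    using arg_min_if_finite[OF fin \<open>S \<noteq> {}\<close>, of gain] by (metis not_le)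
  \<comment> \<open>\<open>r\<close> is the cheapest swap apart from \<open>e\<close> if that swap
    lowers the cost, and otherwise \<open>e\<close>, the code for staying.\<close>
  obtain r where r: "r \<in> S" and z: "(if r = e then 0 else min 0 (gain r)) \<le> 0"
    "\<And>l. l \<in> S \<Longrightarrow> l \<noteq> e \<Longrightarrow> (if r = e then 0 else min 0 (gain r)) \<le> gain l"
  proof (cases "\<exists>l\<in>S - {e}. gain l < 0")
    case True
    then have "finite (S - {e})" "S - {e} \<noteq> {}" using fin by auto
    from arg_min_if_finite[OF this, of gain] obtain r where
      r: "r \<in> S - {e}" "\<And>l. l \<in> S - {e} \<Longrightarrow> gain r \<le> gain l"
      by (metis not_le)
    then show ?thesis using that[of r] by (simp add: min.coboundedI2)
  next
    case False
    then have "0 \<le> gain l" if "l \<in> S" "l \<noteq> e" for l using that by force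
    then show ?thesis using that[of e] e(1) by simp
  qed
  define z where "z = (if r = e then 0 else min 0 (gain r))"
  have z_le: "z \<le> 0" "\<And>l. l \<in> S \<Longrightarrow> l \<noteq> e \<Longrightarrow> z \<le> gain l"
    using z by (auto simp: z_def)
  have items: "e \<in> {1..n}" "r \<in> {1..n}" using e r S selection_item by blast+
  have d: "0 \<le> d l" if "l \<in> S" for l using that S selection_item dev_nonneg by blast
  have partner: "\<sigma> l \<notin> S" if "l \<in> S" for l
    using that S selection_partner selection_item by blast
  \<comment> \<open>The case \<open>j = e\<close> is included: as \<open>e\<close> is cheapest, no
    recovery from an attack on \<open>e\<close> beats \<open>attack_bound e e\<close>.\<close>
  have attack: "\<exists>D\<in>attacks. \<forall>S'\<in>recoveries S. sum c S + attack_bound e j \<le> sum (attacked D) S'"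
    if j: "j \<in> S" for j
  proof (intro bexI ballI)
    show "{j} \<in> attacks" using j S selection_item by (auto simp: attacks_def)
    fix S' assume "S' \<in> recoveries S"
    then consider "S' = S" | l where "l \<in> S" "S' = swap l S" by (auto simp: recoveries_def)
    then show "sum c S + attack_bound e j \<le> sum (attacked {j}) S'"
    proof cases
      case 1
      then show ?thesis using j by (simp add: costs attack_bound_def min_le_iff_disj)
    next
      case (2 l)
      moreover have "j \<noteq> \<sigma> l" using partner[OF 2(1)] j by blast
      ultimately show ?thesis using j e(2)[OF 2(1)]
        by (auto simp: costs attack_bound_def min_def)
    qed
  qed
  have pair: "\<exists>D\<in>attacks. \<forall>S'\<in>recoveries S. sum c S + fallback_bound e r \<le> sum (attacked D) S'"
  proof -
    \<comment> \<open>The term at which \<open>pair_bound\<close> attains its maximum tells the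
      adversary whether to attack nothing, \<open>e\<close> or the partner of
      \<open>e\<close>.\<close>
    have "max (max x y) u \<in> {u, x, y}" for x y u :: real
      by (simp add: max_def)
    from this[of "min (gain e) (d e + z)" "min z (gain e + d (\<sigma> e))" "min 0 (gain e)"]
    consider "fallback_bound e r = min 0 (gain e)" | "fallback_bound e r = min (gain e) (d e + z)"
      | "fallback_bound e r = min z (gain e + d (\<sigma> e))"
      unfolding fallback_bound_def pair_bound_def z_def[symmetric] by blast
    then obtain D where D: "D \<in> {{}, {e}, {\<sigma> e}}"
      "D = {} \<Longrightarrow> fallback_bound e r = min 0 (gain e)"
      "D = {e} \<Longrightarrow> fallback_bound e r = min (gain e) (d e + z)"
      "D = {\<sigma> e} \<Longrightarrow> fallback_bound e r = min z (gain e + d (\<sigma> e))"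
    proof cases
      case 1
      show ?thesis by (rule that[of "{}"]) (use 1 in auto)
    next
      case 2
      show ?thesis by (rule that[of "{e}"]) (use 2 partner_neq[OF items(1)] in auto)
    next
      case 3
      show ?thesis by (rule that[of "{\<sigma> e}"]) (use 3 partner_neq[OF items(1)] in auto)
    qed
    have "D \<in> attacks"
      using D(1) items(1) partner_item[OF items(1)] by (auto simp: attacks_def)
    have "sum c S + fallback_bound e r \<le> sum (attacked D) S'" if "S' \<in> recoveries S" for S'
    proof -
      from that consider "S' = S" | "S' = swap e S" | l where "l \<in> S" "l \<noteq> e" "S' = swap l S"
        by (auto simp: recoveries_def)
      then show ?thesis
      proof cases
        case 1
        then show ?thesis
          using D d[OF e(1)] e(1) z_le(1) partner by (auto simp: costs min_le_iff_disj)
      next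
        case 2
        have "e \<noteq> \<sigma> e" using partner[OF e(1)] e(1) by metis
        with 2 show ?thesis
          using D e(1) partner[OF e(1)] by (auto simp: costs min_le_iff_disj)
      next
        case (3 l)
        have "\<sigma> e \<noteq> \<sigma> l" "e \<noteq> \<sigma> l"
          using 3 items(1) partner_eq_iff S selection_item partner[OF 3(1)] e(1) by blast+
        with 3 show ?thesis
          using D e z_le(2)[OF 3(1,2)] partner[OF e(1)] d[OF e(1)] by (auto simp: costs min_le_iff_disj)
      qed
    qed
    with \<open>D \<in> attacks\<close> show ?thesis by blast
  qed
  define T where "T = insert (fallback_bound e r) (attack_bound e ` S)"
  have T: "finite T" "T \<noteq> {}" using fin by (auto simp: T_def)
  have "S \<in> certified e (Max T)"
    unfolding certified_def using S e(1) r T by (auto simp: T_def intro!: Max_ge)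
  moreover have "Max T \<in> T" using T by (rule Max_in)
  then consider "Max T = fallback_bound e r" | j where "j \<in> S" "Max T = attack_bound e j"
    by (auto simp: T_def)
  then have "\<exists>i\<in>{1..n}. Max T \<in> {attack_bound e i, fallback_bound e i} \<and>
    (\<exists>D\<in>attacks. \<forall>S'\<in>recoveries S. sum c S + Max T \<le> sum (attacked D) S')"
  proof cases
    case 1
    then show ?thesis using pair items(2) by (intro bexI[of _ r]) simp_all
  next
    case (2 j)
    then show ?thesis using attack[OF 2(1)] selection_item[OF S 2(1)] by (intro bexI[of _ j]) simp_all
  qed
  ultimately show ?thesis using items(1) by blast
qed

section \<open>Linear-time minimization for a fixed guess\<close>

definition chosen :: "nat \<Rightarrow> real \<Rightarrow> nat \<Rightarrow> bool" where
  "chosen e t j \<longleftrightarrow> j \<noteq> \<sigma> e \<and> attack_bound e j \<le> t \<and>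
     (j = e \<or> t < attack_bound e (\<sigma> j) \<or> total j < total (\<sigma> j) \<or> total j = total (\<sigma> j) \<and> j < \<sigma> j)"

text \<open>For \<open>j = e\<close> the partner is no way out, because \<open>e\<close> has to be
  selected.\<close>

definition stuck :: "nat \<Rightarrow> real \<Rightarrow> nat \<Rightarrow> bool" where
  "stuck e t j \<longleftrightarrow> t < attack_bound e j \<and> (j = e \<or> t < attack_bound e (\<sigma> j))"

definition fallback :: "nat \<Rightarrow> real \<Rightarrow> nat \<Rightarrow> bool" where
  "fallback e t r \<longleftrightarrow> r \<noteq> \<sigma> e \<and> attack_bound e r \<le> t \<and> fallback_bound e r \<le> t"

text \<open>The extra cost of forcing \<open>j\<close> into the greedy selection. It may be negative
  for a forbidden item, but it is compared only among fallback items, where it is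
  nonnegative.\<close>

definition regret :: "nat \<Rightarrow> real \<Rightarrow> nat \<Rightarrow> real" where
  "regret e t j = (if chosen e t j then 0 else total j - total (\<sigma> j))"

definition greedy :: "nat \<Rightarrow> real \<Rightarrow> nat set" where
  "greedy e t = {j \<in> {1..n}. chosen e t j}"

lemma certified_not_stuck:
  assumes "S \<in> certified e t" "j \<in> {1..n}"
  shows "\<not> stuck e t j"
proof
  assume stuck: "stuck e t j"
  have S: "selection S" "e \<in> S" "\<And>i. i \<in> S \<Longrightarrow> attack_bound e i \<le> t"
    using assms(1) by (auto simp: certified_def)
  have "j \<notin> S" using stuck S(3)[of j] by (auto simp: stuck_def)
  then have "\<sigma> j \<in> S" using selection_partner[OF S(1) assms(2)] by simp
  then show False using stuck S(2) S(3)[of "\<sigma> j"] \<open>j \<notin> S\<close> by (auto simp: stuck_def)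
qed

lemma certified_fallback:
  assumes "S \<in> certified e t"
  shows "\<exists>r\<in>S. fallback e t r"
proof -
  obtain r where S: "selection S" "e \<in> S" "\<And>i. i \<in> S \<Longrightarrow> attack_bound e i \<le> t"
    and r: "r \<in> S" "fallback_bound e r \<le> t"
    using assms by (auto simp: certified_def)
  have "\<sigma> e \<notin> S"
    using selection_partner[OF S(1) selection_item[OF S(1,2)]] S(2) by simp
  then have "fallback e t r" using S(3)[OF r(1)] r by (auto simp: fallback_def)
  with r(1) show ?thesis ..
qed

text \<open>If both items of a pair are allowed and equally expensive, the smaller index decides, so
  exactly one item of each pair is chosen.\<close>

lemma selection_greedy:
  assumes e: "e \<in> {1..n}" and free: "\<And>j. j \<in> {1..n} \<Longrightarrow> \<not> stuck e t j"
  shows "selection (greedy e t)" "e \<in> greedy e t"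
proof -
  have e_chosen: "chosen e t e"
    using free[OF e] partner_neq[OF e] by (auto simp: chosen_def stuck_def)
  have chosen_iff: "chosen e t j \<longleftrightarrow> \<not> chosen e t (\<sigma> j)" if j: "j \<in> {1..n}" for j
  proof -
    note partner = partner_item[OF j] partner_partner[OF j] partner_neq[OF j]
    consider "j = e" | "j = \<sigma> e" | "j \<noteq> e" "j \<noteq> \<sigma> e" "\<sigma> j \<noteq> e" "\<sigma> j \<noteq> \<sigma> e"
      using partner partner_partner[OF e] by metis
    then show ?thesis
    proof cases
      case 1
      then show ?thesis using e_chosen by (simp add: chosen_def)
    next
      case 2
      then show ?thesis using e_chosen partner_partner[OF e] by (simp add: chosen_def)
    next
      case 3
      have "attack_bound e j \<le> t \<or> attack_bound e (\<sigma> j) \<le> t"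
        using free[OF j] by (auto simp: stuck_def)
      with 3 partner show ?thesis
        by (cases "total j" "total (\<sigma> j)" rule: linorder_cases; cases j "\<sigma> j" rule: linorder_cases)
          (auto simp: chosen_def)
    qed
  qed
  show "selection (greedy e t)"
    unfolding selection_def
  proof (intro conjI ballI)
    show "greedy e t \<subseteq> {1..n}" by (auto simp: greedy_def)
    show "i \<in> greedy e t \<longleftrightarrow> \<sigma> i \<notin> greedy e t" if "i \<in> {1..n}" for i
      using chosen_iff[OF that] partner_item[OF that] that unfolding greedy_def by blast
  qed
  show "e \<in> greedy e t"
    using e e_chosen unfolding greedy_def by blast
qed

text \<open>The partner map is a bijection from \<open>S - G\<close> onto \<open>G - S\<close>, so
  \<open>S\<close> arises from \<open>G\<close> by independent exchanges within pairs.\<close>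

lemma sum_selection_diff:
  assumes "selection S" "selection G"
  shows "sum f S = sum f G + (\<Sum>j\<in>S - G. f j - (f (\<sigma> j) :: real))"
proof -
  have "G - S = \<sigma> ` (S - G)"
  proof (intro equalityI subsetI)
    fix j assume j: "j \<in> G - S"
    then have "j \<in> {1..n}" using assms selection_item by blast
    moreover from this have "\<sigma> j \<in> S - G" using j assms selection_partner by blast
    ultimately show "j \<in> \<sigma> ` (S - G)" using partner_partner by force
  next
    fix j assume "j \<in> \<sigma> ` (S - G)"
    then obtain i where i: "i \<in> S - G" "j = \<sigma> i" by blast
    then have "i \<in> {1..n}" using assms selection_item by blast
    then show "j \<in> G - S" using i assms selection_partner by blast
  qed
  moreover have "inj_on \<sigma> (S - G)"
    by (rule inj_onI) (metis DiffD1 assms(1) partner_partner selection_item)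
  ultimately have "sum f (G - S) = (\<Sum>j\<in>S - G. f (\<sigma> j))"
    by (simp add: sum.reindex)
  moreover have "sum f S = sum f (S \<inter> G) + sum f (S - G)" "sum f G = sum f (S \<inter> G) + sum f (G - S)"
    using sum.Int_Diff[OF selection_finite[OF assms(1)], of f G]
      sum.Int_Diff[OF selection_finite[OF assms(2)], of f S] by (simp_all add: Int_commute)
  ultimately show ?thesis by (simp add: sum_subtractf)
qed

lemma total_partner_le:
  assumes e: "e \<in> {1..n}" and "S \<in> certified e t" "j \<in> S" "\<not> chosen e t j"
  shows "total (\<sigma> j) \<le> total j"
proof -
  have S: "selection S" "e \<in> S" "attack_bound e j \<le> t"
    using assms by (auto simp: certified_def)
  then have "\<sigma> e \<notin> S" using selection_partner[OF S(1) e] by simp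
  then have "j \<noteq> \<sigma> e" using assms(3) by blast
  with assms(4) S(3) show ?thesis by (auto simp: chosen_def)
qed

text \<open>A competitor \<open>S'\<close> never gains by departing from the greedy selection in a
  pair. It contains some fallback item, which is either greedy and has regret 0 or is itself a
  departure. Hence \<open>S'\<close> pays at least the regret of that item, and \<open>r\<close> has
  the least regret.\<close>

lemma greedy_optimal:
  assumes e: "e \<in> {1..n}" and free: "\<And>j. j \<in> {1..n} \<Longrightarrow> \<not> stuck e t j"
    and r: "r \<in> {1..n}" "fallback e t r"
    and min: "\<And>j. j \<in> {1..n} \<Longrightarrow> fallback e t j \<Longrightarrow> regret e t r \<le> regret e t j"
  defines "S \<equiv> insert r (greedy e t - {\<sigma> r})"
  shows "S \<in> certified e t" "sum total S = sum total (greedy e t) + regret e t r"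
    "S' \<in> certified e t \<Longrightarrow> sum total S \<le> sum total S'"
proof -
  let ?G = "greedy e t"
  note G = selection_greedy[OF e free]
  have in_G: "j \<in> ?G \<longleftrightarrow> chosen e t j" if "j \<in> {1..n}" for j
    using that by (simp add: greedy_def)
  have r_ne: "r \<noteq> \<sigma> e" using r(2) by (simp add: fallback_def)
  have sel: "selection S"
    unfolding selection_def
  proof (intro conjI ballI)
    show "S \<subseteq> {1..n}" using G(1) r(1) by (auto simp: S_def selection_def)
    fix i assume i: "i \<in> {1..n}"
    have "i = \<sigma> r \<longleftrightarrow> \<sigma> i = r" "i = r \<longleftrightarrow> \<sigma> i = \<sigma> r" "\<sigma> r \<noteq> r"
      using i r(1) by (metis partner_partner, metis partner_partner, metis partner_neq)
    then show "i \<in> S \<longleftrightarrow> \<sigma> i \<notin> S"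
      using selection_partner[OF G(1) i] by (auto simp: S_def)
  qed
  \<comment> \<open>Enforcing \<open>r\<close> must not remove \<open>e\<close>; this is why
    \<open>fallback\<close> excludes \<open>\<sigma> e\<close>.\<close>
  have "e \<noteq> \<sigma> r"
    using r(1) e r_ne by (metis partner_partner)
  then have "e \<in> S" using G(2) by (simp add: S_def)
  moreover have "\<forall>j\<in>S. attack_bound e j \<le> t"
    using r(2) by (auto simp: S_def greedy_def chosen_def fallback_def)
  ultimately show "S \<in> certified e t"
    using sel r(2) unfolding certified_def fallback_def by (auto simp: S_def)
  have S_eq: "S = (if r \<in> ?G then ?G else swap (\<sigma> r) ?G)"
    using selection_partner[OF G(1) r(1)] partner_partner[OF r(1)]
    by (auto simp: S_def swap_def)
  show *: "sum total S = sum total ?G + regret e t r"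
  proof (cases "r \<in> ?G")
    case True
    then show ?thesis using in_G[OF r(1)] by (simp add: S_eq regret_def)
  next
    case False
    then have "\<sigma> r \<in> ?G" using selection_partner[OF G(1) r(1)] by blast
    from sum_swap[OF G(1) this, of total] False show ?thesis
      using in_G[OF r(1)] partner_partner[OF r(1)] by (simp add: S_eq regret_def)
  qed
  show "sum total S \<le> sum total S'" if S': "S' \<in> certified e t"
  proof -
    have sel': "selection S'" using S' by (simp add: certified_def)
    obtain r' where r': "r' \<in> S'" "fallback e t r'" using certified_fallback[OF S'] by blast
    have item: "j \<in> {1..n}" if "j \<in> S'" for j using that sel' selection_item by blast
    have nonneg: "0 \<le> total j - total (\<sigma> j)" if "j \<in> S' - ?G" for j
      using total_partner_le[OF e S', of j] that in_G item by auto
    have fin: "finite (S' - ?G)" using selection_finite[OF sel'] by simp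
    have "regret e t r' \<le> (\<Sum>j\<in>S' - ?G. total j - total (\<sigma> j))"
    proof (cases "r' \<in> ?G")
      case True
      then show ?thesis
        using nonneg in_G[OF item[OF r'(1)]] by (auto simp: regret_def intro!: sum_nonneg)
    next
      case False
      then have "regret e t r' = total r' - total (\<sigma> r')"
        using in_G[OF item[OF r'(1)]] by (simp add: regret_def)
      also have "\<dots> \<le> (\<Sum>j\<in>S' - ?G. total j - total (\<sigma> j))"
        using fin nonneg r'(1) False by (intro member_le_sum) auto
      finally show ?thesis .
    qed
    then show ?thesis
      using min[OF item[OF r'(1)] r'(2)] * sum_selection_diff[OF sel' G(1), of total] by linarith
  qed
qed

end

section \<open>Instances with parts of two items\<close>

definition partner :: "rs_instance \<Rightarrow> nat \<Rightarrow> nat" where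
  "partner I i = (THE k. k \<in> items I \<and> k \<noteq> i \<and> part_index I k = part_index I i)"

locale two_item =
  fixes I :: rs_instance
  assumes two_item: "I \<in> two_item_instances"
begin

lemma valid: "valid_instance I"
  using two_item by (simp add: two_item_instances_def)

lemma part_partner:
  assumes "i \<in> items I"
  shows "part I (part_index I i) = {i, partner I i}" "partner I i \<noteq> i" "partner I i \<in> items I"
    "part_index I (partner I i) = part_index I i"
proof -
  let ?j = "part_index I i"
  note j = valid_part_index[OF valid assms]
  then have "card (part I ?j) = 2" using two_item by (simp add: two_item_instances_def)
  then obtain a b where ab: "part I ?j = {a, b}" "a \<noteq> b" by (auto simp: card_2_iff)
  then have "i = a \<or> i = b" using j(2) by simp
  then obtain k where k: "part I ?j = {i, k}" "k \<noteq> i"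
  proof
    assume "i = a"
    with ab show thesis by (intro that[of b]) auto
  next
    assume "i = b"
    with ab show thesis by (intro that[of a]) auto
  qed
  have "k \<in> part I ?j" using k(1) by simp
  moreover from this have "k \<in> items I"
    using j(1) valid unfolding valid_instance_def by blast
  ultimately have items_k: "k \<in> items I" "part_index I k = ?j"
    using part_index_eq[OF valid j(1)] by simp_all
  have "partner I i = k"
    unfolding partner_def
  proof (rule the_equality)
    show "l = k" if "l \<in> items I \<and> l \<noteq> i \<and> part_index I l = ?j" for l
    proof -
      have "l \<in> part I ?j" using valid_part_index(2)[OF valid, of l] that by simp
      then show ?thesis using k that by blast
    qed
  qed (use items_k k in blast)
  with k items_k show "part I ?j = {i, partner I i}" "partner I i \<noteq> i" "partner I i \<in> items I"
    "part_index I (partner I i) = ?j" by simp_all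
qed

lemma same_part_iff:
  assumes "i \<in> items I" "k \<in> items I"
  shows "part_index I k = part_index I i \<longleftrightarrow> k = i \<or> k = partner I i"
proof
  assume "part_index I k = part_index I i"
  then show "k = i \<or> k = partner I i"
    using part_partner(1)[OF assms(1)] valid_part_index(2)[OF valid assms(2)] by simp
qed (use part_partner(4)[OF assms(1)] in auto)

sublocale pairing "num_items I" "partner I" "first_cost I" "base_cost I" "deviation I"
proof
  fix i assume "i \<in> {1..num_items I}"
  then have i: "i \<in> items I" by (simp add: items_def)
  note p = part_partner[OF i]
  show "partner I i \<in> {1..num_items I}" "partner I i \<noteq> i"
    using p by (simp_all add: items_def)
  show "partner I (partner I i) = i"
    using same_part_iff[OF p(3) i] p(2,4) by auto
  show "0 \<le> deviation I i" using i valid by (simp add: valid_instance_def)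
qed

section \<open>Selections as feasible zero-one vectors\<close>

definition indicator_of :: "nat set \<Rightarrow> nat \<Rightarrow> real" where
  "indicator_of S = (\<lambda>i\<in>items I. if i \<in> S then 1 else 0)"

lemma sum_indicator_of:
  assumes "S \<subseteq> items I"
  shows "(\<Sum>i\<in>items I. f i * indicator_of S i) = sum f S"
proof -
  have "(\<Sum>i\<in>items I. f i * indicator_of S i) = (\<Sum>i\<in>items I. if i \<in> S then f i else 0)"
    by (intro sum.cong) (auto simp: indicator_of_def)
  also have "\<dots> = sum f S"
    using assms by (subst sum.inter_restrict[symmetric]) (auto simp: items_def Int_absorb1)
  finally show ?thesis .
qed

lemma zero_one_function_eq_indicator:
  assumes "x \<in> items I \<rightarrow>\<^sub>E {0, 1}"
  shows "x = indicator_of {i \<in> items I. x i = 1}"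
proof
  fix i show "x i = indicator_of {i \<in> items I. x i = 1} i"
    using assms by (cases "i \<in> items I") (auto simp: indicator_of_def PiE_def extensional_def Pi_def)
qed

lemma indicator_of_mem: "indicator_of S \<in> items I \<rightarrow>\<^sub>E {0, 1}"
  by (auto simp: indicator_of_def)

lemma items_eq: "items I = {1..num_items I}"
  by (simp add: items_def)

lemma feasible_iff:
  assumes "S \<subseteq> items I"
  shows "indicator_of S \<in> feasible I (\<lambda>_. 1) \<longleftrightarrow> selection S"
proof -
  \<comment> \<open>Parts are indexed by their items, which is possible because no part is
    empty.\<close>
  have "(\<forall>j\<in>{1..num_parts I}. (\<Sum>i\<in>part I j. indicator_of S i) = 1) \<longleftrightarrow>
      (\<forall>i\<in>items I. (\<Sum>k\<in>part I (part_index I i). indicator_of S k) = 1)" (is "?L \<longleftrightarrow> ?R")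
  proof
    show ?R if ?L using that valid_part_index(1)[OF valid] by blast
    show ?L if ?R
    proof
      fix j assume j: "j \<in> {1..num_parts I}"
      then have "card (part I j) = 2" using two_item by (simp add: two_item_instances_def)
      then obtain i where i: "i \<in> part I j" by (metis card.empty ex_in_conv zero_neq_numeral)
      then have "i \<in> items I" using j valid unfolding valid_instance_def by blast
      with that part_index_eq[OF valid j i] show "(\<Sum>i\<in>part I j. indicator_of S i) = 1" by auto
    qed
  qed
  also have "\<dots> \<longleftrightarrow> (\<forall>i\<in>items I. i \<in> S \<longleftrightarrow> partner I i \<notin> S)"
  proof (intro ball_cong refl)
    fix i assume i: "i \<in> items I"
    note p = part_partner[OF i]
    have "(\<Sum>k\<in>part I (part_index I i). indicator_of S k) = indicator_of S i + indicator_of S (partner I i)"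
      using p by simp
    then show "(\<Sum>k\<in>part I (part_index I i). indicator_of S k) = 1 \<longleftrightarrow> (i \<in> S \<longleftrightarrow> partner I i \<notin> S)"
      using i p(3) by (simp add: indicator_of_def)
  qed
  finally show ?thesis
    using assms indicator_of_mem by (simp add: feasible_def selection_def items_eq)
qed

lemma selection_subset: "selection S \<Longrightarrow> S \<subseteq> items I"
  by (simp add: selection_def items_def)

lemma feasible_eq: "feasible I (\<lambda>_. 1) = indicator_of ` Collect selection"
proof (intro equalityI subsetI)
  fix x assume x: "x \<in> feasible I (\<lambda>_. 1)"
  let ?S = "{i \<in> items I. x i = 1}"
  have "x = indicator_of ?S"
    using x zero_one_function_eq_indicator by (simp add: feasible_def)
  moreover from this have "selection ?S" using feasible_iff[of ?S] x by auto
  ultimately show "x \<in> indicator_of ` Collect selection" by blast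
next
  fix x assume "x \<in> indicator_of ` Collect selection"
  then show "x \<in> feasible I (\<lambda>_. 1)" using feasible_iff selection_subset by auto
qed

section \<open>Recoveries, scenarios and the objective in terms of selections\<close>

lemma indicator_distance:
  "(\<Sum>i\<in>items I. \<bar>indicator_of S i - indicator_of T i\<bar>) = real (card (items I \<inter> ((S - T) \<union> (T - S))))"
proof -
  have "(\<Sum>i\<in>items I. \<bar>indicator_of S i - indicator_of T i\<bar>) =
      (\<Sum>i\<in>items I. if i \<in> (S - T) \<union> (T - S) then 1 else 0)"
    by (intro sum.cong) (auto simp: indicator_of_def)
  also have "\<dots> = (\<Sum>i\<in>items I \<inter> ((S - T) \<union> (T - S)). 1)"
    by (subst sum.inter_restrict) (auto simp: items_def)
  finally show ?thesis by simp
qed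

lemma selection_swap:
  assumes "selection S" "l \<in> S"
  shows "selection (swap l S)"
  unfolding selection_def
proof (intro conjI ballI)
  note l = selection_item[OF assms]
  show "swap l S \<subseteq> {1..num_items I}"
    using assms(1) partner_item[OF l] by (auto simp: selection_def swap_def)
  fix i assume i: "i \<in> {1..num_items I}"
  have "i = partner I l \<longleftrightarrow> partner I i = l" "i = l \<longleftrightarrow> partner I i = partner I l" "partner I l \<noteq> l"
    using i l by (metis partner_partner, metis partner_partner, metis partner_neq)
  then show "i \<in> swap l S \<longleftrightarrow> partner I i \<notin> swap l S"
    using selection_partner[OF assms(1) i] assms(2) by (auto simp: swap_def)
qed

lemma distance_swap:
  assumes "selection S" "l \<in> S"
  shows "card (items I \<inter> ((S - swap l S) \<union> (swap l S - S))) = 2"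
proof -
  note l = selection_item[OF assms]
  have "partner I l \<notin> S" using selection_partner[OF assms(1) l] assms(2) by simp
  then have "items I \<inter> ((S - swap l S) \<union> (swap l S - S)) = {l, partner I l}"
    using assms(2) l partner_item[OF l] unfolding swap_def items_eq by blast
  then show ?thesis using partner_neq[OF l] by (simp add: card_insert_if)
qed

text \<open>Selections differ in whole pairs, since a removed item forces its partner in. Two
  exchanged pairs would already contribute four items.\<close>

lemma swap_of_distance:
  assumes S: "selection S" and T: "selection T"
    and dist: "card (items I \<inter> ((S - T) \<union> (T - S))) \<le> 2"
  shows "T \<in> recoveries S"
proof (rule ccontr)
  assume T_not: "T \<notin> recoveries S"
  have moved: "partner I i \<in> T - S" if "i \<in> S - T" for i
    using that selection_partner[OF S, of i] selection_partner[OF T, of i] selection_item[OF S, of i] by simp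
  have moved': "partner I i \<in> S - T" if "i \<in> T - S" for i
    using that selection_partner[OF S, of i] selection_partner[OF T, of i] selection_item[OF T, of i] by simp
  have "T \<noteq> S" using T_not by (auto simp: recoveries_def)
  then have "S - T \<noteq> {}" using moved' by blast
  then obtain l where l: "l \<in> S - T" by blast
  have "T \<noteq> swap l S" using T_not l by (auto simp: recoveries_def)
  have "\<exists>m \<in> S - T. m \<noteq> l"
  proof (rule ccontr)
    assume "\<not> ?thesis"
    then have ST: "S - T = {l}" using l by blast
    have "T - S = {partner I l}"
    proof (intro equalityI subsetI)
      fix i assume i: "i \<in> T - S"
      then have "partner I i = l" using moved'[OF i] ST by blast
      moreover have "partner I (partner I i) = i"
        using i selection_item[OF T] partner_partner by blast
      ultimately show "i \<in> {partner I l}" by simp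
    qed (use moved[OF l] in simp)
    moreover have "T = (S - A) \<union> B" if "S - T = A" "T - S = B" for A B
      using that by blast
    ultimately have "T = swap l S" using ST by (simp add: swap_def)
    with \<open>T \<noteq> swap l S\<close> show False ..
  qed
  then obtain m where m: "m \<in> S - T" "m \<noteq> l" by blast
  have items: "l \<in> {1..num_items I}" "m \<in> {1..num_items I}"
    using l m selection_item[OF S] by blast+
  let ?X = "{l, m, partner I l, partner I m}"
  have ne: "partner I l \<noteq> partner I m" using m(2) partner_eq_iff[OF items] by simp
  have "partner I l \<notin> S" "partner I m \<notin> S" "l \<in> S" "m \<in> S"
    using moved[OF l] moved[OF m(1)] l m(1) by blast+
  then have "l \<noteq> partner I l" "l \<noteq> partner I m" "m \<noteq> partner I l" "m \<noteq> partner I m"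
    by metis+
  with ne have "distinct [l, m, partner I l, partner I m]" using m(2) by simp
  from distinct_card[OF this] have "card ?X = 4" by simp
  moreover have "?X \<subseteq> items I \<inter> ((S - T) \<union> (T - S))"
    using moved[OF l] moved[OF m(1)] l m selection_subset[OF S] selection_subset[OF T] by blast
  then have "card ?X \<le> card (items I \<inter> ((S - T) \<union> (T - S)))"
    by (intro card_mono) (auto simp: items_def)
  ultimately show False using dist by simp
qed

lemma recovery_eq:
  assumes S: "selection S"
  shows "recovery I (\<lambda>_. 1) 1 (indicator_of S) = indicator_of ` recoveries S"
proof (intro equalityI subsetI)
  fix y assume "y \<in> recovery I (\<lambda>_. 1) 1 (indicator_of S)"
  then obtain T where T: "y = indicator_of T" "selection T"
    and "(\<Sum>i\<in>items I. \<bar>indicator_of S i - indicator_of T i\<bar>) \<le> 2"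
    unfolding recovery_def feasible_eq by auto
  then have "card (items I \<inter> ((S - T) \<union> (T - S))) \<le> 2"
    unfolding indicator_distance by simp
  with swap_of_distance[OF S T(2)] T(1) show "y \<in> indicator_of ` recoveries S" by blast
next
  fix y assume "y \<in> indicator_of ` recoveries S"
  then consider "y = indicator_of S" | l where "l \<in> S" "y = indicator_of (swap l S)"
    by (auto simp: recoveries_def)
  then show "y \<in> recovery I (\<lambda>_. 1) 1 (indicator_of S)"
  proof cases
    case 1
    then show ?thesis using S unfolding recovery_def feasible_eq by simp
  next
    case (2 l)
    then show ?thesis
      using selection_swap[OF S 2(1)] distance_swap[OF S 2(1)]
      unfolding recovery_def feasible_eq by (simp add: 2(2) indicator_distance)
  qed
qed

text \<open>With budget 1 a deviation vector is the indicator of at most one item. The restriction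
  matches the scenarios, which are extensional functions on the items.\<close>

lemma uncertainty_eq: "uncertainty I 1 = (\<lambda>D. restrict (attacked D) (items I)) ` attacks"
proof (intro equalityI subsetI)
  fix c assume "c \<in> uncertainty I 1"
  then obtain \<delta> where c: "c = (\<lambda>i\<in>items I. base_cost I i + deviation I i * \<delta> i)"
    and \<delta>: "\<delta> \<in> items I \<rightarrow>\<^sub>E {0, 1}" "(\<Sum>i\<in>items I. \<delta> i) \<le> 1"
    by (auto simp: uncertainty_def)
  let ?D = "{i \<in> items I. \<delta> i = 1}"
  have eq: "\<delta> = indicator_of ?D" by (rule zero_one_function_eq_indicator[OF \<delta>(1)])
  have "real (card ?D) = (\<Sum>i\<in>items I. 1 * indicator_of ?D i)"
    by (subst sum_indicator_of) auto
  also have "\<dots> \<le> 1" using \<delta>(2) eq by simp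
  finally have "card ?D \<le> Suc 0" by simp
  then have unique: "p = q" if "p \<in> ?D" "q \<in> ?D" for p q
    using that card_le_Suc0_iff_eq[of ?D] by (simp add: items_def)
  have "?D \<in> attacks"
  proof (cases "?D = {}")
    case False
    then obtain q where q: "q \<in> ?D" by blast
    then have "?D = {q}" using unique by blast
    with q show ?thesis by (simp add: attacks_def items_eq)
  qed (simp add: attacks_def)
  moreover have "c = restrict (attacked ?D) (items I)"
  proof (unfold c, rule restrict_ext)
    fix i assume "i \<in> items I"
    then show "base_cost I i + deviation I i * \<delta> i = attacked ?D i"
      using \<delta>(1) by (auto simp: attacked_def PiE_def Pi_def)
  qed
  ultimately show "c \<in> (\<lambda>D. restrict (attacked D) (items I)) ` attacks" by blast
next
  fix c assume "c \<in> (\<lambda>D. restrict (attacked D) (items I)) ` attacks"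
  then obtain D where D: "D \<in> attacks" and c: "c = restrict (attacked D) (items I)" by blast
  have sub: "D \<subseteq> items I" and "card D \<le> 1" using D by (auto simp: attacks_def items_eq)
  have "(\<Sum>i\<in>items I. indicator_of D i) = real (card D)"
    using sum_indicator_of[OF sub, of "\<lambda>_. 1"] by simp
  then have "(\<Sum>i\<in>items I. indicator_of D i) \<le> real 1" using \<open>card D \<le> 1\<close> by simp
  moreover have "c = (\<lambda>i\<in>items I. base_cost I i + deviation I i * indicator_of D i)"
    unfolding c by (rule restrict_ext) (simp add: attacked_def indicator_of_def)
  ultimately show "c \<in> uncertainty I 1"
    unfolding uncertainty_def using indicator_of_mem by blast
qed

lemma objective_indicator_of:
  assumes S: "selection S"
  shows "objective I (\<lambda>_. 1) 1 1 (indicator_of S) =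
    sum (first_cost I) S + (MAX D\<in>attacks. MIN T\<in>recoveries S. sum (attacked D) T)"
proof -
  have "(MIN y\<in>recovery I (\<lambda>_. 1) 1 (indicator_of S). \<Sum>i\<in>items I. restrict (attacked D) (items I) i * y i)
      = (MIN T\<in>recoveries S. sum (attacked D) T)" for D
  proof -
    have "(\<Sum>i\<in>items I. restrict (attacked D) (items I) i * indicator_of T i) = sum (attacked D) T"
      if "T \<in> recoveries S" for T
    proof -
      have "selection T" using that S selection_swap by (auto simp: recoveries_def)
      from sum_indicator_of[OF selection_subset[OF this], of "attacked D"]
      show ?thesis by simp
    qed
    then show ?thesis
      unfolding recovery_eq[OF S] image_image by (simp cong: image_cong)
  qed
  then show ?thesis
    unfolding objective_def uncertainty_eq image_image
    by (simp add: sum_indicator_of selection_subset[OF S])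
qed

lemma finite_recoveries: "selection S \<Longrightarrow> finite (recoveries S)"
  using selection_finite by (simp add: recoveries_def)

lemma finite_attacks: "finite attacks"
  by (simp add: attacks_def)

lemma sum_total: "sum total S = sum (first_cost I) S + sum (base_cost I) S"
  by (simp add: total_def sum.distrib)

lemma objective_le:
  assumes "S \<in> certified e t"
  shows "objective I (\<lambda>_. 1) 1 1 (indicator_of S) \<le> sum total S + t"
proof -
  have S: "selection S" using assms by (simp add: certified_def)
  have "(MIN T\<in>recoveries S. sum (attacked D) T) \<le> sum (base_cost I) S + t" if "D \<in> attacks" for D
    using certified_recovery[OF assms that] finite_recoveries[OF S]
    by (subst Min_le_iff) (auto simp: recoveries_def)
  then have "(MAX D\<in>attacks. MIN T\<in>recoveries S. sum (attacked D) T) \<le> sum (base_cost I) S + t"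
    using finite_attacks by (subst Max_le_iff) (auto simp: attacks_def)
  then show ?thesis
    unfolding objective_indicator_of[OF S] sum_total by simp
qed

text \<open>A positive number of items guarantees that there is an item to serve as
  \<open>e\<close>.\<close>

lemma objective_ge:
  assumes S: "selection S" and "num_items I > 0"
  shows "\<exists>e\<in>{1..num_items I}. \<exists>i\<in>{1..num_items I}. \<exists>t\<in>{attack_bound e i, fallback_bound e i}.
    S \<in> certified e t \<and> sum total S + t \<le> objective I (\<lambda>_. 1) 1 1 (indicator_of S)"
proof -
  obtain e i t D where e: "e \<in> {1..num_items I}" "i \<in> {1..num_items I}"
    "t \<in> {attack_bound e i, fallback_bound e i}" "S \<in> certified e t"
    and D: "D \<in> attacks" "\<And>T. T \<in> recoveries S \<Longrightarrow> sum (base_cost I) S + t \<le> sum (attacked D) T"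
    using exists_certificate[OF assms] by blast
  have "sum (base_cost I) S + t \<le> (MIN T\<in>recoveries S. sum (attacked D) T)"
    using D(2) finite_recoveries[OF S] by (subst Min_ge_iff) (auto simp: recoveries_def)
  also have "\<dots> \<le> (MAX D\<in>attacks. MIN T\<in>recoveries S. sum (attacked D) T)"
    using D(1) finite_attacks by (intro Max_ge) auto
  finally have "sum total S + t \<le> objective I (\<lambda>_. 1) 1 1 (indicator_of S)"
    unfolding objective_indicator_of[OF S] sum_total by simp
  with e show ?thesis by blast
qed

end

section \<open>The algorithm\<close>

text \<open>Adding real register 0, which is always 0, acts as a copy.\<close>

definition rmin :: "nat \<Rightarrow> nat \<Rightarrow> nat \<Rightarrow> cmd" where
  "rmin r a b = Cond (Atom (RLess a b)) (Do (RArith r Plus a 0)) (Do (RArith r Plus b 0))"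

definition rmax :: "nat \<Rightarrow> nat \<Rightarrow> nat \<Rightarrow> cmd" where
  "rmax r a b = Cond (Atom (RLess a b)) (Do (RArith r Plus b 0)) (Do (RArith r Plus a 0))"

lemma den_rmin: "rreg s 0 = 0 \<Longrightarrow> den (rmin r a b) s = s\<lparr>rreg := (rreg s)(r := min (rreg s a) (rreg s b))\<rparr>"
  by (simp add: rmin_def)

lemma den_rmax: "rreg s 0 = 0 \<Longrightarrow> den (rmax r a b) s = s\<lparr>rreg := (rreg s)(r := max (rreg s a) (rreg s b))\<rparr>"
  by (simp add: rmax_def)

text \<open>Index registers: 2 and 3 hold \<open>e\<close> and its partner, 4 the item that provides the threshold, 6
  and 7 the scanned item and its partner, 8 whether some pair is stuck, 10 the best fallback so
  far, 13 whether a solution was found; 11 is always 0. Index arrays: 2 the partners, 3 the greedy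
  selection. Real registers: 9 the threshold, 12 the cost of the greedy selection, 13 the least
  regret, 20 the best value; 0 is always 0. Real arrays: 3 \<open>gain\<close>, 4 \<open>total\<close>,
  5 \<open>attack_bound e\<close>, 6 \<open>fallback_bound e\<close>. The other registers are temporary.\<close>

definition find_partners :: cmd where
  "find_partners =
     For 2 (For 4 (Do (ILoad 14 0 2) ;; Do (ILoad 15 0 4) ;;
       Cond (Conj (Atom (IEq 14 15)) (Neg (Atom (IEq 2 4)))) (Do (IStore 2 2 4)) Pass))"

definition item_data :: cmd where
  "item_data =
     For 6 (Do (ILoad 7 2 6) ;; Do (RLoad 1 0 6) ;; Do (RLoad 2 1 6) ;; Do (RLoad 3 1 7) ;;
       Do (RArith 4 Plus 1 2) ;; Do (RStore 4 6 4) ;; Do (RArith 4 Minus 3 2) ;; Do (RStore 3 6 4))"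

text \<open>Expects in real registers 1 to 4 the quantities \<open>gain e\<close>, the deviation of
  \<open>e\<close>, \<open>gain e\<close> plus the deviation of its partner, and
  \<open>min 0 (gain e)\<close>.\<close>

definition item_bounds :: cmd where
  "item_bounds =
     Do (RLoad 5 3 6) ;; Do (RLoad 6 2 6) ;; Do (RArith 6 Plus 6 4) ;; rmin 6 5 6 ;; Do (RStore 5 6 6) ;;
     rmin 5 0 5 ;; Do (RArith 7 Plus 2 5) ;; rmin 7 1 7 ;; rmin 8 5 3 ;; rmax 7 7 8 ;; rmax 7 7 4 ;;
     Do (RStore 6 6 7)"

text \<open>The loop treats \<open>e\<close> like any other item, although its fallback has relative
  cost 0 instead of \<open>min 0 (gain e)\<close>. The last instructions repair this entry of array
  6 from the entries of \<open>e\<close> and its partner.\<close>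

definition bounds :: cmd where
  "bounds =
     (Do (ILoad 3 2 2) ;; Do (RLoad 1 3 2) ;; Do (RLoad 2 2 2) ;; Do (RLoad 3 2 3) ;;
      Do (RArith 3 Plus 1 3) ;; rmin 4 0 1) ;;
     For 6 item_bounds ;;
     (Do (RLoad 5 6 2) ;; Do (RLoad 6 6 3) ;; rmax 5 5 6 ;; Do (RStore 6 2 5))"

definition load_item :: cmd where
  "load_item = Do (ILoad 7 2 6) ;; Do (RLoad 14 5 6) ;; Do (RLoad 15 5 7) ;; Do (RLoad 16 4 6) ;;
     Do (RLoad 17 4 7) ;; Do (RLoad 18 6 6)"

definition choose_item :: cmd where
  "choose_item =
     Cond (Conj (Neg (Atom (IEq 6 3))) (Conj (Neg (Atom (RLess 9 14)))
       (Disj (Atom (IEq 6 2)) (Disj (Atom (RLess 9 15)) (Disj (Atom (RLess 16 17))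
         (Conj (Atom (REq 16 17)) (Atom (ILess 6 7))))))))
       (Do (IConst 14 1) ;; Do (RArith 12 Plus 12 16) ;; Do (RConst 19 0))
       (Do (IConst 14 0) ;; Do (RArith 19 Minus 16 17)) ;;
     Do (IStore 3 6 14)"

definition check_item :: cmd where
  "check_item =
     Cond (Conj (Atom (RLess 9 14)) (Disj (Atom (IEq 6 2)) (Atom (RLess 9 15))))
       (Do (IConst 8 1)) Pass"

text \<open>Items start at 1, so 0 in register 10 means that no fallback has been seen. Real
  register 19 still holds the regret left by \<open>choose_item\<close>.\<close>

definition update_fallback :: cmd where
  "update_fallback =
     Cond (Conj (Neg (Atom (IEq 6 3))) (Conj (Neg (Atom (RLess 9 14))) (Conj (Neg (Atom (RLess 9 18)))
       (Disj (Atom (IEq 10 11)) (Atom (RLess 19 13))))))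
       (Do (ICopy 10 6) ;; Do (RArith 13 Plus 19 0)) Pass"

definition scan :: cmd where
  "scan = Do (IConst 8 0) ;; Do (IConst 10 0) ;; Do (RConst 12 0) ;;
     For 6 (load_item ;; choose_item ;; check_item ;; update_fallback)"

text \<open>The swap that enforces the fallback item is carried out only here; the scan leaves the
  plain greedy selection in array 3.\<close>

definition accept :: cmd where
  "accept = (Do (RArith 20 Plus 21 0) ;; Do (IConst 13 1) ;; Do (ILoad 7 2 10) ;;
     Do (IConst 14 0) ;; Do (IStore 3 7 14) ;; Do (IConst 14 1) ;; Do (IStore 3 10 14)) ;;
     For 6 (Do (ILoad 14 3 6) ;; Do (IStore 1 6 14))"

definition try_threshold :: cmd where
  "try_threshold = scan ;;
     Cond (Conj (Atom (IEq 8 11)) (Neg (Atom (IEq 10 11))))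
       (Do (RArith 21 Plus 12 13) ;; Do (RArith 21 Plus 21 9) ;;
        Cond (Disj (Atom (IEq 13 11)) (Atom (RLess 21 20))) accept Pass)
       Pass"

definition main :: cmd where
  "main = find_partners ;; item_data ;;
     For 2 (bounds ;; For 4 (Do (RLoad 9 5 4) ;; try_threshold ;; Do (RLoad 9 6 4) ;; try_threshold))"

lemmas program_defs = rmin_def rmax_def find_partners_def item_data_def item_bounds_def bounds_def
  load_item_def choose_item_def check_item_def update_fallback_def scan_def accept_def
  try_threshold_def main_def

text \<open>Depth 3 is the exponent of the time bound: loops over \<open>e\<close>, over the item
  that provides the threshold, and over the scanned items.\<close>

lemma main_wellformed: "loops_ok main" "IReg 0 \<notin> writes main" "additive main" "depth main = 3"
  by (simp_all add: program_defs)

section \<open>Correctness of the program\<close>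

context two_item
begin

definition prepared :: "state \<Rightarrow> bool" where
  "prepared s \<longleftrightarrow> ireg s 0 = num_items I \<and> ireg s 11 = 0 \<and> rreg s 0 = 0 \<and>
     (\<forall>j\<in>items I. iarr s 2 j = partner I j \<and> rarr s 2 j = deviation I j \<and>
        rarr s 3 j = gain j \<and> rarr s 4 j = total j)"

definition bounded :: "nat \<Rightarrow> state \<Rightarrow> bool" where
  "bounded e s \<longleftrightarrow> ireg s 2 = e \<and> ireg s 3 = partner I e \<and>
     (\<forall>j\<in>items I. rarr s 5 j = attack_bound e j \<and> rarr s 6 j = fallback_bound e j)"

definition scanned :: "nat \<Rightarrow> real \<Rightarrow> nat \<Rightarrow> state \<Rightarrow> bool" where
  "scanned e t k s \<longleftrightarrow>
     (\<forall>j\<in>{1..k}. iarr s 3 j = of_bool (chosen e t j)) \<and>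
     rreg s 12 = (\<Sum>j | j \<in> {1..k} \<and> chosen e t j. total j) \<and>
     (ireg s 8 = 0 \<longleftrightarrow> (\<forall>j\<in>{1..k}. \<not> stuck e t j)) \<and>
     (if ireg s 10 = 0 then \<forall>j\<in>{1..k}. \<not> fallback e t j
      else ireg s 10 \<in> {1..k} \<and> fallback e t (ireg s 10) \<and> rreg s 13 = regret e t (ireg s 10) \<and>
        (\<forall>j\<in>{1..k}. fallback e t j \<longrightarrow> regret e t (ireg s 10) \<le> regret e t j))"

text \<open>The stored selection may be certified by any guess, not necessarily one in
  \<open>F\<close>, because every certificate bounds the objective from above. Only minimality
  refers to the guesses in \<open>F\<close>.\<close>

definition best :: "(nat \<times> real) set \<Rightarrow> state \<Rightarrow> bool" where
  "best F s \<longleftrightarrow>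
     (if ireg s 13 = 0 then \<forall>(e, t)\<in>F. certified e t = {}
      else (\<exists>e t. \<exists>S\<in>certified e t. (\<forall>j\<in>items I. iarr s 1 j = of_bool (j \<in> S)) \<and> rreg s 20 = sum total S + t) \<and>
        (\<forall>(e, t)\<in>F. \<forall>S\<in>certified e t. rreg s 20 \<le> sum total S + t))"

lemma prepared_agree:
  assumes "prepared s" "agree_off W s s'"
    "{IReg 0, IReg 11, RReg 0, IArr 2, RArr 2, RArr 3, RArr 4} \<inter> W = {}"
  shows "prepared s'"
  using assms by (simp add: prepared_def agree_off_def)

lemma bounded_agree:
  assumes "bounded e s" "agree_off W s s'" "{IReg 2, IReg 3, RArr 5, RArr 6} \<inter> W = {}"
  shows "bounded e s'"
  using assms by (simp add: bounded_def agree_off_def)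

lemma best_agree:
  assumes "best F s" "agree_off W s s'" "{IReg 13, IArr 1, RReg 20} \<inter> W = {}"
  shows "best F s'"
proof -
  have "ireg s' 13 = ireg s 13" "iarr s' 1 = iarr s 1" "rreg s' 20 = rreg s 20"
    using assms(2,3) by (simp_all add: agree_off_def)
  with assms(1) show ?thesis by (simp only: best_def)
qed

lemma den_find_partners:
  assumes "ireg s 0 = num_items I" "\<And>i. i \<in> items I \<Longrightarrow> iarr s 0 i = part_index I i"
  shows "\<forall>j\<in>items I. iarr (den find_partners s) 2 j = partner I j"
proof -
  let ?Q = "\<lambda>k s. \<forall>j\<in>{1..k}. iarr s 2 j = partner I j"
  let ?inner = "Do (ILoad 14 0 2) ;; Do (ILoad 15 0 4) ;;
       Cond (Conj (Atom (IEq 14 15)) (Neg (Atom (IEq 2 4)))) (Do (IStore 2 2 4)) Pass"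
  have "?Q (ireg s 0) (den (For 2 (For 4 ?inner)) s)"
  proof (rule For_invariant[where Q = ?Q])
    fix k s' assume k: "k < ireg s 0" and Q: "?Q k s'"
      and frame: "agree_off (insert (IReg 2) (writes (For 4 ?inner))) s s'"
    let ?j = "Suc k" and ?s = "set_ireg 2 (Suc k) s'"
    \<comment> \<open>The cell of the current item is correct once the inner loop has passed its
      partner; the cells of earlier items are preserved.\<close>
    let ?R = "\<lambda>m s. (\<forall>j\<in>{1..k}. iarr s 2 j = partner I j) \<and>
      (partner I ?j \<le> m \<longrightarrow> iarr s 2 ?j = partner I ?j)"
    have j: "?j \<in> items I" using k assms(1) by (simp add: items_def)
    have n: "ireg ?s 0 = num_items I" using frame assms(1) by (simp add: agree_off_def)
    have "?R (ireg ?s 0) (den (For 4 ?inner) ?s)"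
    proof (rule For_invariant[where Q = ?R])
      show "?R 0 (set_ireg 4 0 ?s)"
        using Q part_partner(3)[OF j] by (simp add: items_def)
    next
      fix m s'' assume m: "m < ireg ?s 0" and R: "?R m s''"
        and frame': "agree_off (insert (IReg 4) (writes ?inner)) ?s s''"
      have i: "Suc m \<in> items I" using m n by (simp add: items_def)
      have "iarr s'' 0 = iarr s 0" "ireg s'' 2 = ?j"
        using frame frame' by (simp_all add: agree_off_def)
      moreover have "part_index I ?j = part_index I (Suc m) \<and> k \<noteq> m \<longleftrightarrow> Suc m = partner I ?j"
        using same_part_iff[OF j i] part_partner(2)[OF j] by auto
      ultimately show "?R (Suc m) (den ?inner (set_ireg 4 (Suc m) s''))"
        using R i j assms(2) by (auto simp: le_Suc_eq)
    qed
    then have R: "?R (num_items I) (den (For 4 ?inner) ?s)" using n by simp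
    moreover have "partner I ?j \<le> num_items I" using part_partner(3)[OF j] by (simp add: items_def)
    ultimately show "?Q (Suc k) (den (For 4 ?inner) ?s)"
      by (auto simp: le_Suc_eq simp del: den.simps)
  qed simp
  then show ?thesis
    using assms(1) by (simp add: find_partners_def items_def del: den.simps)
qed

lemma den_item_data:
  assumes "ireg s 0 = num_items I" "\<forall>j\<in>items I. iarr s 2 j = partner I j"
    "\<And>j. j \<in> items I \<Longrightarrow> rarr s 0 j = first_cost I j" "\<And>j. j \<in> items I \<Longrightarrow> rarr s 1 j = base_cost I j"
  shows "\<forall>j\<in>items I. rarr (den item_data s) 3 j = gain j \<and> rarr (den item_data s) 4 j = total j"
proof -
  let ?Q = "\<lambda>k s. \<forall>j\<in>{1..k}. rarr s 3 j = gain j \<and> rarr s 4 j = total j"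
  have "?Q (ireg s 0) (den item_data s)"
    unfolding item_data_def
  proof (rule For_invariant[where Q = ?Q])
    fix k s' assume k: "k < ireg s 0" and Q: "?Q k s'"
      and frame: "agree_off (insert (IReg 6) (writes (Do (ILoad 7 2 6) ;; Do (RLoad 1 0 6) ;;
        Do (RLoad 2 1 6) ;; Do (RLoad 3 1 7) ;; Do (RArith 4 Plus 1 2) ;; Do (RStore 4 6 4) ;;
        Do (RArith 4 Minus 3 2) ;; Do (RStore 3 6 4)))) s s'"
    have j: "Suc k \<in> items I" using k assms(1) by (simp add: items_def)
    have "iarr s' 2 = iarr s 2" "rarr s' 0 = rarr s 0" "rarr s' 1 = rarr s 1"
      using frame by (simp_all add: agree_off_def)
    then show "?Q (Suc k) (den (Do (ILoad 7 2 6) ;; Do (RLoad 1 0 6) ;;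
        Do (RLoad 2 1 6) ;; Do (RLoad 3 1 7) ;; Do (RArith 4 Plus 1 2) ;; Do (RStore 4 6 4) ;;
        Do (RArith 4 Minus 3 2) ;; Do (RStore 3 6 4)) (set_ireg 6 (Suc k) s'))"
      using Q j part_partner(3)[OF j] assms(2-4) by (auto simp: le_Suc_eq gain_def total_def)
  qed simp
  then show ?thesis
    using assms(1) by (simp add: items_def)
qed

lemma den_item_bounds:
  assumes "prepared s" "ireg s 6 = j" "j \<in> items I" "rreg s 1 = gain e" "rreg s 2 = deviation I e"
    "rreg s 3 = gain e + deviation I (partner I e)" "rreg s 4 = min 0 (gain e)"
  shows "rarr (den item_bounds s) = (rarr s)(5 := (rarr s 5)(j := attack_bound e j),
    6 := (rarr s 6)(j := pair_bound e (min 0 (gain j))))"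
  using assms
  by (simp add: item_bounds_def den_rmin den_rmax prepared_def attack_bound_def pair_bound_def)

lemma pair_bound_mono: "z \<le> z' \<Longrightarrow> pair_bound e z \<le> pair_bound e z'"
  unfolding pair_bound_def by (intro max.mono min.mono add_mono) auto

lemma den_bounds:
  assumes s: "prepared s" and e: "ireg s 2 = e" "e \<in> items I"
  shows "bounded e (den bounds s)"
proof -
  define init where "init = Do (ILoad 3 2 2) ;; Do (RLoad 1 3 2) ;; Do (RLoad 2 2 2) ;;
    Do (RLoad 3 2 3) ;; Do (RArith 3 Plus 1 3) ;; rmin 4 0 1"
  define finish where "finish = Do (RLoad 5 6 2) ;; Do (RLoad 6 6 3) ;; rmax 5 5 6 ;; Do (RStore 6 2 5)"
  define s1 where "s1 = den init s"
  define s2 where "s2 = den (For 6 item_bounds) s1"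
  note p = part_partner[OF e(2)]
  have s1: "prepared s1" "ireg s1 2 = e" "ireg s1 3 = partner I e" "rreg s1 1 = gain e"
    "rreg s1 2 = deviation I e" "rreg s1 3 = gain e + deviation I (partner I e)" "rreg s1 4 = min 0 (gain e)"
    using s e p(3) by (simp_all add: s1_def init_def den_rmin prepared_def)
  let ?Q = "\<lambda>k s. \<forall>j\<in>{1..k}. rarr s 5 j = attack_bound e j \<and> rarr s 6 j = pair_bound e (min 0 (gain j))"
  have "?Q (ireg s1 0) s2"
    unfolding s2_def
  proof (rule For_invariant[where Q = ?Q])
    fix k s' assume k: "k < ireg s1 0" and Q: "?Q k s'"
      and frame: "agree_off (insert (IReg 6) (writes item_bounds)) s1 s'"
    let ?s = "set_ireg 6 (Suc k) s'"
    have frame': "agree_off (insert (IReg 6) (writes item_bounds)) s1 ?s"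
      by (rule agree_off_trans[OF frame agree_off_set_ireg])
    have "prepared ?s"
      by (rule prepared_agree[OF s1(1) frame']) (simp add: item_bounds_def rmin_def rmax_def)
    moreover have "rreg ?s 1 = gain e" "rreg ?s 2 = deviation I e"
      "rreg ?s 3 = gain e + deviation I (partner I e)" "rreg ?s 4 = min 0 (gain e)"
      using s1 frame' by (simp_all add: agree_off_def item_bounds_def rmin_def rmax_def)
    moreover have "Suc k \<in> items I" using k s1(1) by (simp add: prepared_def items_def)
    ultimately have "rarr (den item_bounds ?s) = (rarr s')(5 := (rarr s' 5)(Suc k := attack_bound e (Suc k)),
        6 := (rarr s' 6)(Suc k := pair_bound e (min 0 (gain (Suc k)))))"
      by (subst den_item_bounds) simp_all
    then show "?Q (Suc k) (den item_bounds ?s)"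
      using Q by (auto simp: le_Suc_eq)
  qed simp
  then have Q: "\<forall>j\<in>items I. rarr s2 5 j = attack_bound e j \<and> rarr s2 6 j = pair_bound e (min 0 (gain j))"
    using s1(1) by (simp add: prepared_def items_def)
  have frame: "agree_off (insert (IReg 6) (writes item_bounds)) s1 s2"
    unfolding s2_def using agree_off_den[of "For 6 item_bounds" s1] by simp
  have s2: "rreg s2 0 = 0" "ireg s2 2 = e" "ireg s2 3 = partner I e"
    using s1 frame by (simp_all add: agree_off_def item_bounds_def rmin_def rmax_def prepared_def)
  \<comment> \<open>\<open>gain\<close> changes sign at the partner, so one of the two truncated
    gains is 0. By monotonicity of \<open>pair_bound\<close> that entry is the larger one.\<close>
  have "max (pair_bound e (min 0 (gain e))) (pair_bound e (min 0 (gain (partner I e)))) = pair_bound e 0"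
  proof -
    have "gain (partner I e) = - gain e"
      using partner_partner[of e] e(2) by (simp add: gain_def items_def)
    then have "min 0 (gain e) = 0 \<or> min 0 (gain (partner I e)) = 0" by auto
    then show ?thesis
      using pair_bound_mono[of "min 0 (gain e)" 0 e] pair_bound_mono[of "min 0 (gain (partner I e))" 0 e]
      by auto
  qed
  then have "bounded e (den finish s2)"
    using Q s2 e p(3) by (simp add: finish_def den_rmax bounded_def fallback_bound_def)
  moreover have "den bounds s = den finish s2"
    by (simp add: bounds_def init_def finish_def s1_def s2_def)
  ultimately show ?thesis by simp
qed

lemma scanned_agree:
  assumes "scanned e t k s" "agree_off W s s'" "{IReg 8, IReg 10, IArr 3, RReg 12, RReg 13} \<inter> W = {}"
  shows "scanned e t k s'"
proof -
  have eqs: "ireg s' 8 = ireg s 8" "ireg s' 10 = ireg s 10" "iarr s' 3 = iarr s 3"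
    "rreg s' 12 = rreg s 12" "rreg s' 13 = rreg s 13"
    using assms(2,3) by (simp_all add: agree_off_def)
  show ?thesis
    unfolding scanned_def eqs using assms(1)[unfolded scanned_def] .
qed

lemma den_scan_item:
  assumes s: "prepared s" "bounded e s" "rreg s 9 = t" and j: "ireg s 6 = Suc k" "Suc k \<in> items I"
    and scanned: "scanned e t k s"
  shows "scanned e t (Suc k) (den (load_item ;; choose_item ;; check_item ;; update_fallback) s)"
proof -
  let ?j = "Suc k"
  note p = part_partner[OF j(2)]
  define s1 where "s1 = den load_item s"
  have regs: "ireg s1 6 = ?j" "ireg s1 7 = partner I ?j" "ireg s1 2 = e" "ireg s1 3 = partner I e"
    "rreg s1 9 = t" "rreg s1 14 = attack_bound e ?j" "rreg s1 15 = attack_bound e (partner I ?j)"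
    "rreg s1 16 = total ?j" "rreg s1 17 = total (partner I ?j)" "rreg s1 18 = fallback_bound e ?j"
    "rreg s1 0 = 0" "ireg s1 11 = 0"
    using s j p(3) by (simp_all add: s1_def load_item_def prepared_def bounded_def)
  have cells: "iarr s1 3 = iarr s 3" "rreg s1 12 = rreg s 12" "ireg s1 8 = ireg s 8"
    "ireg s1 10 = ireg s 10" "rreg s1 13 = rreg s 13"
    by (simp_all add: s1_def load_item_def)
  define s2 where "s2 = den choose_item s1"
  have regs2: "ireg s2 6 = ?j" "ireg s2 2 = e" "ireg s2 3 = partner I e" "ireg s2 11 = 0"
    "rreg s2 9 = t" "rreg s2 14 = attack_bound e ?j" "rreg s2 15 = attack_bound e (partner I ?j)"
    "rreg s2 18 = fallback_bound e ?j" "rreg s2 0 = 0"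
    "ireg s2 8 = ireg s 8" "ireg s2 10 = ireg s 10" "rreg s2 13 = rreg s 13"
    unfolding s2_def by (subst den_unwritten; simp add: choose_item_def regs cells)+
  \<comment> \<open>Each compound test is first identified with the predicate it decides, so that
    the updates can be computed by cases on that predicate.\<close>
  have sat: "sat (Conj (Neg (Atom (IEq 6 3))) (Conj (Neg (Atom (RLess 9 14)))
       (Disj (Atom (IEq 6 2)) (Disj (Atom (RLess 9 15)) (Disj (Atom (RLess 16 17))
         (Conj (Atom (REq 16 17)) (Atom (ILess 6 7)))))))) s1 \<longleftrightarrow> chosen e t ?j"
    by (simp add: regs chosen_def not_less)
  have s2: "s2 = den (Do (IStore 3 6 14)) (if chosen e t ?j
      then den (Do (IConst 14 1) ;; Do (RArith 12 Plus 12 16) ;; Do (RConst 19 0)) s1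
      else den (Do (IConst 14 0) ;; Do (RArith 19 Minus 16 17)) s1)"
    unfolding s2_def choose_item_def den.simps(3,4) sat by (rule refl)
  have choose: "iarr s2 3 = (iarr s 3)(?j := of_bool (chosen e t ?j))"
    "rreg s2 12 = rreg s 12 + (if chosen e t ?j then total ?j else 0)" "rreg s2 19 = regret e t ?j"
    by (cases "chosen e t ?j"; simp add: s2 regs cells regret_def)+
  define s3 where "s3 = den check_item s2"
  have sat3: "sat (Conj (Atom (RLess 9 14)) (Disj (Atom (IEq 6 2)) (Atom (RLess 9 15)))) s2 \<longleftrightarrow> stuck e t ?j"
    by (simp add: regs2 stuck_def)
  have s3: "s3 = (if stuck e t ?j then set_ireg 8 1 s2 else s2)"
    unfolding s3_def check_item_def den.simps step.simps sat3 ..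
  define s4 where "s4 = den update_fallback s3"
  have sat4: "sat (Conj (Neg (Atom (IEq 6 3))) (Conj (Neg (Atom (RLess 9 14))) (Conj (Neg (Atom (RLess 9 18)))
       (Disj (Atom (IEq 10 11)) (Atom (RLess 19 13)))))) s3 \<longleftrightarrow>
      fallback e t ?j \<and> (ireg s 10 = 0 \<or> regret e t ?j < rreg s 13)"
    by (auto simp: s3 regs2 choose fallback_def)
  have s4: "s4 = (if fallback e t ?j \<and> (ireg s 10 = 0 \<or> regret e t ?j < rreg s 13)
      then s3\<lparr>ireg := (ireg s3)(10 := ?j), rreg := (rreg s3)(13 := regret e t ?j)\<rparr> else s3)"
    unfolding s4_def update_fallback_def den.simps sat4
    by (intro if_cong) (simp_all add: s3 regs2 choose)
  have cells4: "iarr s4 3 = iarr s2 3" "rreg s4 12 = rreg s2 12"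
    "ireg s4 8 = (if stuck e t ?j then 1 else ireg s 8)"
    "ireg s4 10 = (if fallback e t ?j \<and> (ireg s 10 = 0 \<or> regret e t ?j < rreg s 13) then ?j else ireg s 10)"
    "rreg s4 13 = (if fallback e t ?j \<and> (ireg s 10 = 0 \<or> regret e t ?j < rreg s 13) then regret e t ?j else rreg s 13)"
    by (auto simp: s4 s3 regs2)
  have Suc_k: "{1..Suc k} = insert ?j {1..k}" by auto
  have "scanned e t (Suc k) s4"
    unfolding scanned_def
  proof (intro conjI)
    note old = scanned[unfolded scanned_def]
    show "\<forall>i\<in>{1..Suc k}. iarr s4 3 i = of_bool (chosen e t i)"
      unfolding Suc_k cells4 choose using old by auto
    have "{i. i \<in> {1..Suc k} \<and> chosen e t i} =
        (if chosen e t ?j then insert ?j {i. i \<in> {1..k} \<and> chosen e t i} else {i. i \<in> {1..k} \<and> chosen e t i})"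
      unfolding Suc_k by auto
    then show "rreg s4 12 = (\<Sum>i | i \<in> {1..Suc k} \<and> chosen e t i. total i)"
      unfolding cells4 choose using old by simp
    show "ireg s4 8 = 0 \<longleftrightarrow> (\<forall>i\<in>{1..Suc k}. \<not> stuck e t i)"
      unfolding Suc_k cells4 using old by simp
    show "if ireg s4 10 = 0 then \<forall>i\<in>{1..Suc k}. \<not> fallback e t i
      else ireg s4 10 \<in> {1..Suc k} \<and> fallback e t (ireg s4 10) \<and>
        rreg s4 13 = regret e t (ireg s4 10) \<and>
        (\<forall>i\<in>{1..Suc k}. fallback e t i \<longrightarrow> regret e t (ireg s4 10) \<le> regret e t i)"
    proof (cases "fallback e t ?j \<and> (ireg s 10 = 0 \<or> regret e t ?j < rreg s 13)")
      case True
      then have "regret e t ?j \<le> regret e t i" if "i \<in> {1..k}" "fallback e t i" for i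
        using old that by (cases "ireg s 10 = 0") force+
      with True show ?thesis unfolding Suc_k cells4 by simp
    next
      case False
      then show ?thesis
        unfolding Suc_k cells4 using old by (cases "ireg s 10 = 0") auto
    qed
  qed
  then show ?thesis by (simp add: s1_def s2_def s3_def s4_def)
qed

lemma den_scan:
  assumes s: "prepared s" "bounded e s" "rreg s 9 = t"
  shows "scanned e t (num_items I) (den scan s)"
proof -
  let ?body = "load_item ;; choose_item ;; check_item ;; update_fallback"
  define s1 where "s1 = den (Do (IConst 8 0) ;; Do (IConst 10 0) ;; Do (RConst 12 0)) s"
  have s1: "prepared s1" "bounded e s1" "rreg s1 9 = t" "ireg s1 8 = 0" "ireg s1 10 = 0" "rreg s1 12 = 0"
    using s by (simp_all add: s1_def prepared_def bounded_def)
  have "scanned e t (ireg s1 0) (den (For 6 ?body) s1)"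
  proof (rule For_invariant)
    show "scanned e t 0 (set_ireg 6 0 s1)" using s1 by (simp add: scanned_def)
  next
    fix k s' assume k: "k < ireg s1 0" and scanned: "scanned e t k s'"
      and frame: "agree_off (insert (IReg 6) (writes ?body)) s1 s'"
    let ?s = "set_ireg 6 (Suc k) s'"
    note frame' = agree_off_trans[OF frame agree_off_set_ireg]
    have "prepared ?s"
      by (rule prepared_agree[OF s1(1) frame']) (simp add: program_defs)
    moreover have "bounded e ?s"
      by (rule bounded_agree[OF s1(2) frame']) (simp add: program_defs)
    moreover have "rreg ?s 9 = t"
      using frame s1(3) by (simp add: agree_off_def program_defs)
    moreover have "Suc k \<in> items I" using k s1(1) by (simp add: prepared_def items_def)
    moreover have "scanned e t k ?s"
      by (rule scanned_agree[OF scanned agree_off_set_ireg[where W = "{}"]]) simp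
    ultimately show "scanned e t (Suc k) (den ?body ?s)"
      by (intro den_scan_item) simp_all
  qed
  then show ?thesis
    using s1(1) by (simp add: prepared_def scan_def s1_def)
qed

lemma den_accept:
  assumes s: "prepared s" and r: "ireg s 10 = r" "r \<in> items I"
  shows "\<forall>j\<in>items I. iarr (den accept s) 1 j = (if j = r then 1 else if j = partner I r then 0 else iarr s 3 j)"
    "ireg (den accept s) 13 = 1" "rreg (den accept s) 20 = rreg s 21"
proof -
  let ?copy = "Do (ILoad 14 3 6) ;; Do (IStore 1 6 14)"
  define s1 where "s1 = den (Do (RArith 20 Plus 21 0) ;; Do (IConst 13 1) ;; Do (ILoad 7 2 10) ;;
     Do (IConst 14 0) ;; Do (IStore 3 7 14) ;; Do (IConst 14 1) ;; Do (IStore 3 10 14)) s"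
  have s1: "iarr s1 3 = (iarr s 3)(partner I r := 0, r := 1)" "ireg s1 13 = 1" "rreg s1 20 = rreg s 21"
    "ireg s1 0 = num_items I"
    using assms by (simp_all add: s1_def prepared_def)
  let ?Q = "\<lambda>k s. \<forall>j\<in>{1..k}. iarr s 1 j = iarr s1 3 j"
  have "?Q (ireg s1 0) (den (For 6 ?copy) s1)"
  proof (rule For_invariant[where Q = ?Q])
    fix k s' assume "?Q k s'" and frame: "agree_off (insert (IReg 6) (writes ?copy)) s1 s'"
    moreover have "iarr s' 3 = iarr s1 3" using frame by (simp add: agree_off_def)
    ultimately show "?Q (Suc k) (den ?copy (set_ireg 6 (Suc k) s'))"
      by (auto simp: le_Suc_eq)
  qed simp
  moreover have accept: "den accept s = den (For 6 ?copy) s1"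
    by (simp add: accept_def s1_def)
  ultimately show "\<forall>j\<in>items I. iarr (den accept s) 1 j =
      (if j = r then 1 else if j = partner I r then 0 else iarr s 3 j)"
    using s1 by (simp add: items_def del: den.simps)
  show "ireg (den accept s) 13 = 1" "rreg (den accept s) 20 = rreg s 21"
    unfolding accept using s1 by (simp_all add: den_unwritten del: den.simps)
qed

text \<open>Covers both reasons to reject a guess: it certifies nothing, or the stored value is
  already at least as good.\<close>

lemma best_insertI:
  assumes "best F s" "\<And>S. S \<in> certified e t \<Longrightarrow> ireg s 13 \<noteq> 0 \<and> rreg s 20 \<le> sum total S + t"
  shows "best (insert (e, t) F) s"
proof (cases "ireg s 13 = 0")
  case True
  then have "certified e t = {}" using assms(2) by blast
  with True assms(1) show ?thesis by (simp add: best_def)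
next
  case False
  with assms(1) obtain e' t' S where "S \<in> certified e' t'" "\<forall>j\<in>items I. iarr s 1 j = of_bool (j \<in> S)"
    "rreg s 20 = sum total S + t'"
    and F: "\<forall>(e, t)\<in>F. \<forall>S\<in>certified e t. rreg s 20 \<le> sum total S + t"
    unfolding best_def by auto
  then have "\<exists>e t. \<exists>S\<in>certified e t. (\<forall>j\<in>items I. iarr s 1 j = of_bool (j \<in> S)) \<and> rreg s 20 = sum total S + t"
    by blast
  moreover have "\<forall>(e, t)\<in>insert (e, t) F. \<forall>S\<in>certified e t. rreg s 20 \<le> sum total S + t"
    using F assms(2) by blast
  ultimately show ?thesis unfolding best_def if_not_P[OF False] by (rule conjI)
qed

text \<open>A stuck pair or a missing fallback means that the guess certifies nothing. Otherwise
  real register 21 receives the minimum for this guess by \<open>greedy_optimal\<close>.\<close>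

lemma den_try_threshold:
  assumes s: "prepared s" "bounded e s" "rreg s 9 = t" and e: "e \<in> items I" and best: "best F s"
  shows "best (insert (e, t) F) (den try_threshold s)"
proof -
  define s1 where "s1 = den scan s"
  have frame: "agree_off (writes scan) s s1" unfolding s1_def by (rule agree_off_den)
  have s1: "prepared s1" "best F s1"
    by (rule prepared_agree[OF s(1) frame] best_agree[OF best frame]; simp add: program_defs)+
  have t: "rreg s1 9 = t" using frame s(3) by (simp add: agree_off_def program_defs)
  have scanned: "scanned e t (num_items I) s1"
    unfolding s1_def by (rule den_scan[OF s])
  have best_unchanged: "best (insert (e, t) F) s1" if "certified e t = {}"
    using s1(2) that by (intro best_insertI) simp_all
  show ?thesis
  proof (cases "ireg s1 8 = 0 \<and> ireg s1 10 \<noteq> 0")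
    case False
    have "certified e t = {}"
    proof (rule ccontr)
      assume "certified e t \<noteq> {}"
      then obtain S where S: "S \<in> certified e t" by blast
      obtain r where r: "r \<in> S" "fallback e t r" using certified_fallback[OF S] by blast
      then have "r \<in> {1..num_items I}" using S selection_item by (auto simp: certified_def)
      then show False
        using False r certified_not_stuck[OF S] scanned by (auto simp: scanned_def split: if_splits)
    qed
    moreover have "den try_threshold s = s1"
      using False s1(1) by (auto simp: try_threshold_def s1_def prepared_def)
    ultimately show ?thesis using best_unchanged by simp
  next
    case True
    define r where "r = ireg s1 10"
    have free: "\<And>j. j \<in> {1..num_items I} \<Longrightarrow> \<not> stuck e t j"
      and r: "r \<in> {1..num_items I}" "fallback e t r" "rreg s1 13 = regret e t r"
      and min: "\<And>j. j \<in> {1..num_items I} \<Longrightarrow> fallback e t j \<Longrightarrow> regret e t r \<le> regret e t j"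
      and cost: "rreg s1 12 = sum total (greedy e t)"
      and trial: "\<And>j. j \<in> items I \<Longrightarrow> iarr s1 3 j = of_bool (j \<in> greedy e t)"
      using True scanned by (auto simp: scanned_def r_def greedy_def items_def)
    define S where "S = insert r (greedy e t - {partner I r})"
    have S: "S \<in> certified e t" "sum total S = sum total (greedy e t) + regret e t r"
      unfolding S_def by (rule greedy_optimal; fact e[unfolded items_eq] free r(1,2) min)+
    have S_least: "sum total S \<le> sum total S'" if "S' \<in> certified e t" for S'
      unfolding S_def
      by (rule greedy_optimal; fact e[unfolded items_eq] free r(1,2) min that)+
    define s2 where "s2 = den (Do (RArith 21 Plus 12 13) ;; Do (RArith 21 Plus 21 9)) s1"
    have s2: "rreg s2 21 = sum total S + t" "ireg s2 10 = r" "iarr s2 3 = iarr s1 3"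
      "ireg s2 13 = ireg s1 13" "rreg s2 20 = rreg s1 20" "ireg s2 11 = 0"
      using S(2) cost r(3) t s1(1) by (simp_all add: s2_def r_def prepared_def)
    have frame2: "agree_off {RReg 21} s1 s2" by (simp add: s2_def agree_off_def)
    have prep2: "prepared s2" and best2: "best F s2"
      by (rule prepared_agree[OF s1(1) frame2] best_agree[OF s1(2) frame2]; simp)+
    have den: "den try_threshold s =
      (if ireg s1 13 = 0 \<or> rreg s2 21 < rreg s1 20 then den accept s2 else s2)"
      using True s1(1) s2 by (simp add: try_threshold_def s1_def[symmetric] s2_def prepared_def)
    show ?thesis
    proof (cases "ireg s1 13 = 0 \<or> rreg s2 21 < rreg s1 20")
      case True
      note accept = den_accept[OF prep2 s2(2) r(1)[folded items_eq]]
      have "iarr (den accept s2) 1 j = of_bool (j \<in> S)" if "j \<in> items I" for j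
        using that accept(1) trial[OF that] partner_neq[OF r(1)] by (simp add: S_def s2)
      then have found: "\<exists>e t. \<exists>S\<in>certified e t. (\<forall>j\<in>items I. iarr (den accept s2) 1 j = of_bool (j \<in> S)) \<and>
          rreg (den accept s2) 20 = sum total S + t"
        using S(1) accept(3) s2(1) by (intro exI[of _ e] exI[of _ t] bexI[of _ S] conjI ballI) simp_all
      have least: "rreg (den accept s2) 20 \<le> sum total S' + t'"
        if "(e', t') \<in> insert (e, t) F" "S' \<in> certified e' t'" for e' t' S'
      proof (cases "(e', t') = (e, t)")
        case True
        then show ?thesis using S_least that(2) accept(3) s2(1) by simp
      next
        case False
        then have F: "(e', t') \<in> F" using that(1) by auto
        \<comment> \<open>An earlier guess that certifies something forces a stored value, so the
          new one was accepted as a strict improvement.\<close>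
        have nonzero: "ireg s1 13 \<noteq> 0"
        proof
          assume "ireg s1 13 = 0"
          then have "\<forall>(e, t)\<in>F. certified e t = {}" using s1(2) by (simp add: best_def)
          with F that(2) show False by blast
        qed
        from s1(2)[unfolded best_def if_not_P[OF this]]
        have "\<forall>(e, t)\<in>F. \<forall>S\<in>certified e t. rreg s1 20 \<le> sum total S + t" ..
        with F that(2) have "rreg s1 20 \<le> sum total S' + t'" by blast
        then show ?thesis using True nonzero accept(3) s2(1) by simp
      qed
      have "best (insert (e, t) F) (den accept s2)"
        unfolding best_def accept(2) if_not_P[OF one_neq_zero]
      proof (rule conjI[OF found], rule ballI)
        fix p assume "p \<in> insert (e, t) F"
        then show "case p of (e, t) \<Rightarrow> \<forall>S\<in>certified e t. rreg (den accept s2) 20 \<le> sum total S + t"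
          using least[of "fst p" "snd p"] by (simp add: case_prod_beta)
      qed
      then show ?thesis using True den by simp
    next
      case False
      then have "rreg s2 20 \<le> sum total S' + t" if "S' \<in> certified e t" for S'
        using S_least[OF that] s2 by simp
      then have "best (insert (e, t) F) s2"
        using best2 False s2(4) by (intro best_insertI) simp_all
      then show ?thesis using False den by simp
    qed
  qed
qed

definition candidates :: "nat \<Rightarrow> nat \<Rightarrow> (nat \<times> real) set" where
  "candidates e m = {(e, t) | t. \<exists>i\<in>{1..m}. t = attack_bound e i \<or> t = fallback_bound e i}"

lemma candidates_Suc: "candidates e (Suc m) =
    insert (e, fallback_bound e (Suc m)) (insert (e, attack_bound e (Suc m)) (candidates e m))"
proof -
  have "{1..Suc m} = insert (Suc m) {1..m}" by auto
  then show ?thesis by (auto simp: candidates_def)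
qed

lemma den_thresholds:
  fixes try_item
  defines "try_item \<equiv> Do (RLoad 9 5 4) ;; try_threshold ;; Do (RLoad 9 6 4) ;; try_threshold"
  assumes s: "prepared s" "bounded e s" and e: "e \<in> items I" and best: "best F s"
  shows "best (F \<union> candidates e (num_items I)) (den (For 4 try_item) s)"
proof -
  let ?Q = "\<lambda>m. best (F \<union> candidates e m)"
  have "?Q (ireg s 0) (den (For 4 try_item) s)"
  proof (rule For_invariant[where Q = ?Q])
    show "?Q 0 (set_ireg 4 0 s)"
      using best_agree[OF best agree_off_set_ireg[where W = "{}"]] by (simp add: candidates_def)
  next
    fix m s' assume m: "m < ireg s 0" and best: "?Q m s'"
      and frame: "agree_off (insert (IReg 4) (writes try_item)) s s'"
    let ?i = "Suc m"
    have i: "?i \<in> items I" using m s(1) by (simp add: prepared_def items_def)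
    define s1 where "s1 = den (Do (RLoad 9 5 4)) (set_ireg 4 ?i s')"
    define s2 where "s2 = den try_threshold s1"
    define s3 where "s3 = den (Do (RLoad 9 6 4)) s2"
    have frame1: "agree_off {IReg 4, RReg 9} s' s1" by (simp add: s1_def agree_off_def)
    have frame1': "agree_off (insert (IReg 4) (writes try_item)) s s1"
      by (rule agree_off_trans[OF frame agree_off_mono[OF frame1]]) (simp add: try_item_def)
    have frame2: "agree_off (writes try_threshold) s1 s2"
      unfolding s2_def by (rule agree_off_den)
    have frame3: "agree_off {RReg 9} s2 s3" by (simp add: s3_def agree_off_def)
    have s1: "prepared s1" "bounded e s1"
      by (rule prepared_agree[OF s(1) frame1'] bounded_agree[OF s(2) frame1'];
          simp add: try_item_def program_defs)+
    have "rreg s1 9 = attack_bound e ?i"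
    proof -
      have "rarr s1 5 = rarr s' 5" by (simp add: s1_def)
      then show ?thesis using s1(2) i by (simp add: s1_def bounded_def)
    qed
    moreover have "best (F \<union> candidates e m) s1"
      by (rule best_agree[OF best frame1]) simp
    ultimately have best2: "best (insert (e, attack_bound e ?i) (F \<union> candidates e m)) s2"
      unfolding s2_def using s1 e by (intro den_try_threshold)
    have s2: "prepared s2" "bounded e s2"
      by (rule prepared_agree[OF s1(1) frame2] bounded_agree[OF s1(2) frame2]; simp add: program_defs)+
    have s3: "prepared s3" "bounded e s3"
      by (rule prepared_agree[OF s2(1) frame3] bounded_agree[OF s2(2) frame3]; simp)+
    have "ireg s2 4 = ?i"
      using frame2 by (simp add: agree_off_def program_defs s1_def)
    then have "rreg s3 9 = fallback_bound e ?i"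
      using s2(2) i by (simp add: s3_def bounded_def)
    moreover have "best (insert (e, attack_bound e ?i) (F \<union> candidates e m)) s3"
      by (rule best_agree[OF best2 frame3]) simp
    ultimately have "best (insert (e, fallback_bound e ?i) (insert (e, attack_bound e ?i) (F \<union> candidates e m)))
        (den try_threshold s3)"
      using s3 e by (intro den_try_threshold)
    then show "?Q ?i (den try_item (set_ireg 4 ?i s'))"
      by (simp add: try_item_def s1_def s2_def s3_def candidates_Suc)
  qed
  then show ?thesis using s(1) by (simp add: prepared_def)
qed

lemma den_main: "best (\<Union>e\<in>items I. candidates e (num_items I)) (den main (initial I))"
proof -
  define s1 where "s1 = den find_partners (initial I)"
  define s2 where "s2 = den item_data s1"
  define thresholds where "thresholds =
    For 4 (Do (RLoad 9 5 4) ;; try_threshold ;; Do (RLoad 9 6 4) ;; try_threshold)"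
  have frame1: "agree_off (writes find_partners) (initial I) s1"
    unfolding s1_def by (rule agree_off_den)
  have frame2: "agree_off (writes item_data) s1 s2"
    unfolding s2_def by (rule agree_off_den)
  have partners: "\<forall>j\<in>items I. iarr s1 2 j = partner I j"
    unfolding s1_def by (rule den_find_partners) (simp_all add: initial_def)
  have s1: "ireg s1 0 = num_items I" "ireg s1 11 = 0" "ireg s1 13 = 0" "rreg s1 0 = 0"
    "rarr s1 = rarr (initial I)"
    using frame1 by (simp_all add: agree_off_def program_defs initial_def fun_eq_iff)
  have "\<forall>j\<in>items I. rarr s2 3 j = gain j \<and> rarr s2 4 j = total j"
    unfolding s2_def by (rule den_item_data[OF s1(1) partners]) (simp_all add: s1 initial_def)
  then have s2: "prepared s2" "ireg s2 13 = 0"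
    using frame2 s1 partners by (simp_all add: agree_off_def program_defs initial_def prepared_def)
  let ?Q = "\<lambda>k. best (\<Union>e\<in>{1..k}. candidates e (num_items I))"
  have "?Q (ireg s2 0) (den (For 2 (bounds ;; thresholds)) s2)"
  proof (rule For_invariant[where Q = ?Q])
    show "?Q 0 (set_ireg 2 0 s2)" using s2(2) by (simp add: best_def)
  next
    fix k s' assume k: "k < ireg s2 0" and best: "?Q k s'"
      and frame: "agree_off (insert (IReg 2) (writes (bounds ;; thresholds))) s2 s'"
    let ?s = "set_ireg 2 (Suc k) s'"
    have e: "Suc k \<in> items I" using k s2(1) by (simp add: prepared_def items_def)
    have prep: "prepared ?s"
      by (rule prepared_agree[OF s2(1) agree_off_trans[OF frame agree_off_set_ireg]])
        (simp add: program_defs thresholds_def)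
    have best: "?Q k (den bounds ?s)"
      by (rule best_agree[OF best agree_off_trans[OF
          agree_off_set_ireg[where W = "writes bounds"] agree_off_mono[OF agree_off_den]]])
        (simp_all add: program_defs)
    have "prepared (den bounds ?s)"
      by (rule prepared_agree[OF prep agree_off_den]) (simp add: program_defs)
    moreover have "bounded (Suc k) (den bounds ?s)"
      by (rule den_bounds[OF prep _ e]) simp
    ultimately have "best ((\<Union>e\<in>{1..k}. candidates e (num_items I)) \<union> candidates (Suc k) (num_items I))
        (den thresholds (den bounds ?s))"
      unfolding thresholds_def using e best by (intro den_thresholds)
    moreover have "(\<Union>e\<in>{1..Suc k}. candidates e (num_items I)) =
        (\<Union>e\<in>{1..k}. candidates e (num_items I)) \<union> candidates (Suc k) (num_items I)"
      using atLeastAtMostSuc_conv[of 1 k] by auto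
    ultimately show "?Q (Suc k) (den (bounds ;; thresholds) ?s)" by simp
  qed
  moreover have "den main (initial I) = den (For 2 (bounds ;; thresholds)) s2"
    by (simp add: main_def thresholds_def s1_def s2_def)
  ultimately show ?thesis
    using s2(1) by (simp add: prepared_def items_eq)
qed

text \<open>The objective of the output is at most the stored value. That value is at most the
  guessed cost of any competitor under its right guess, which in turn is at most the objective of
  the competitor.\<close>

lemma optimal_solution_main: "optimal_solution I (\<lambda>_. 1) 1 1 (solution I (den main (initial I)))"
proof (cases "num_items I = 0")
  case True
  \<comment> \<open>Without items no guess is ever tried, but the empty selection is the only
    one.\<close>
  then have "selection S \<longleftrightarrow> S = {}" for S unfolding selection_def by auto
  then have "Collect selection = {{}}" by auto
  then have "feasible I (\<lambda>_. 1) = {indicator_of {}}" unfolding feasible_eq by simp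
  moreover have "solution I s = indicator_of {}" for s
    unfolding solution_def indicator_of_def by (rule restrict_ext) (use True in \<open>simp add: items_def\<close>)
  ultimately show ?thesis by (simp add: optimal_solution_def is_arg_min_def)
next
  case False
  let ?s = "den main (initial I)"
  let ?F = "\<Union>e\<in>items I. candidates e (num_items I)"
  have certificate: "\<exists>e t. (e, t) \<in> ?F \<and> S \<in> certified e t \<and>
      sum total S + t \<le> objective I (\<lambda>_. 1) 1 1 (indicator_of S)" if S: "selection S" for S
  proof -
    have "num_items I > 0" using False by simp
    from objective_ge[OF S this] obtain e i t where e: "e \<in> items I" "i \<in> items I" "t \<in> {attack_bound e i, fallback_bound e i}"
      and t: "S \<in> certified e t" "sum total S + t \<le> objective I (\<lambda>_. 1) 1 1 (indicator_of S)"
      unfolding items_eq[symmetric] by (elim bexE conjE) (rule that; assumption)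
    have "(e, t) \<in> candidates e (num_items I)"
      unfolding candidates_def using e by (auto simp: items_eq)
    then have "(e, t) \<in> ?F" using e(1) by blast
    with t show ?thesis by blast
  qed
  \<comment> \<open>Taking the smaller item of each pair shows that a selection exists; its
    certificate ensures that some solution is stored.\<close>
  have "selection {i \<in> items I. i < partner I i}"
    unfolding selection_def
  proof (intro conjI ballI)
    fix i assume i: "i \<in> {1..num_items I}"
    note p = partner_item[OF i] partner_partner[OF i] partner_neq[OF i]
    then have "i < partner I i \<longleftrightarrow> \<not> partner I i < partner I (partner I i)" by linarith
    with i p(1) show "i \<in> {i \<in> items I. i < partner I i} \<longleftrightarrow>
        partner I i \<notin> {i \<in> items I. i < partner I i}"
      unfolding items_eq by blast
  qed (simp add: items_eq subset_iff)
  from certificate[OF this] obtain e t where "(e, t) \<in> ?F" "certified e t \<noteq> {}" by blast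
  have found: "ireg ?s 13 \<noteq> 0"
  proof
    assume "ireg ?s 13 = 0"
    from den_main[unfolded best_def if_P[OF this]]
    have "\<forall>(e, t)\<in>?F. certified e t = {}" .
    with \<open>(e, t) \<in> ?F\<close> \<open>certified e t \<noteq> {}\<close> show False by blast
  qed
  note result = den_main[unfolded best_def if_not_P[OF found]]
  from conjunct1[OF result] obtain e t S where
    S: "S \<in> certified e t" "\<forall>j\<in>items I. iarr ?s 1 j = of_bool (j \<in> S)" "rreg ?s 20 = sum total S + t"
    by blast
  note least = conjunct2[OF result]
  have "solution I ?s = indicator_of S"
    unfolding solution_def indicator_of_def by (rule restrict_ext) (use S(2) in simp)
  moreover have "indicator_of S \<in> feasible I (\<lambda>_. 1)"
    using S(1) unfolding feasible_eq certified_def by blast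
  moreover have "objective I (\<lambda>_. 1) 1 1 (indicator_of S) \<le> objective I (\<lambda>_. 1) 1 1 y"
    if y: "y \<in> feasible I (\<lambda>_. 1)" for y
  proof -
    obtain T where T: "selection T" "y = indicator_of T"
      using y unfolding feasible_eq by blast
    obtain e' t' where "(e', t') \<in> ?F" "T \<in> certified e' t'"
      and le: "sum total T + t' \<le> objective I (\<lambda>_. 1) 1 1 (indicator_of T)"
      using certificate[OF T(1)] by blast
    then have "rreg ?s 20 \<le> sum total T + t'" using least by blast
    with objective_le[OF S(1)] S(3) le show ?thesis unfolding T(2) by linarith
  qed
  ultimately show ?thesis
    unfolding optimal_solution_def is_arg_min_def by (metis not_less)
qed

end

theorem theorem5:
  shows "\<exists>P :: prog.
    solves P two_item_instances (\<lambda>_. 1) 1 1 \<and>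
    strongly_polynomial P two_item_instances \<and>
    (\<exists>f :: nat \<Rightarrow> nat. time_bounded P two_item_instances f \<and>
       (\<lambda>n. real (f n)) \<in> O(\<lambda>n. real n ^ 3))"
proof (intro exI[of _ "compile main"] conjI)
  show "solves (compile main) two_item_instances (\<lambda>_. 1) 1 1"
    unfolding solves_def
  proof
    fix I assume "I \<in> two_item_instances"
    then interpret two_item I by unfold_locales
    show "\<exists>t m s. exec (compile main) (initial I) t m s \<and> optimal_solution I (\<lambda>_. 1) 1 1 (solution I s)"
      using exec_initial[OF main_wellformed(1,2), of I] optimal_solution_main by blast
  qed
  show "strongly_polynomial (compile main) two_item_instances"
    by (rule strongly_polynomial_compile[OF main_wellformed(1-3)])
  show "\<exists>f. time_bounded (compile main) two_item_instances f \<and> (\<lambda>n. real (f n)) \<in> O(\<lambda>n. real n ^ 3)"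
    by (rule time_bounded_compile) (simp_all add: main_wellformed)
qed

end
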